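(* Let $(R,\mathfrak{m})$ be a local ring with infinite residue field and $\operatorname{depth} R>0$, and let $I$ be a reduction of $\mathfrak{m}$. Set $\alpha=\max\{\mathrm{r}_I(\mathfrak{m}),\, s(\mathfrak{m})-1\}$. Then $$n_2(I)\leq n_3(I)=n_1(I)=\alpha.$$
   Context: All rings are commutative, Noetherian and unital; a local ring is such a ring with a unique maximal ideal $\mathfrak{m}$. For ideals $A,B$ and an element $x$ of $R$, $A:B=\{r\in R\mid rB\subseteq A\}$ and $A:x=A:(x)$. Convention: $\mathfrak{m}^0=R$. Let $(R,\mathfrak{m})$ be a local ring with infinite residue field and let $J$ be an ideal of $R$. - $J$ is $\mathfrak{m}$-full if $J\mathfrak{m}:x=J$ for some element $x\in\mathfrak{m}\setminus\mathfrak{m}^2$. - $J$ is full if $J:x=J:\mathfrak{m}$ for some element $x\in\mathfrak{m}\setminus\mathfrak{m}^2$. - $J$ is weakly $\mathfrak{m}$-full if $J\mathfrak{m}:\mathfrak{m}=J$. If moreover $\operatorname{depth} R>0$ (i.e. $\mathfrak{m}$ contains a non-zero-divisor of $R$), then for an ideal $I$ of $R$ set - $n_1(I)=\min\{t\geq 0\mid I\mathfrak{m}^n \text{ is } \mathfrak{m}\text{-full for all } n\geq t\}$; - $n_2(I)=\min\{t\geq 0\mid I\mathfrak{m}^n \text{ is full for all } n\geq t\}$; - $n_3(I)=\min\{t\geq 0\mid I\mathfrak{m}^n \text{ is weakly } \mathfrak{m}\text{-full for all } n\geq t\}$. It is known (H. Dao) that these minima exist. An ideal $I\subseteq\mathfrak{m}$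 is a reduction of $\mathfrak{m}$ if $I\mathfrak{m}^r=\mathfrak{m}^{r+1}$ for some integer $r\geq 0$; its reduction number is $\mathrm{r}_I(\mathfrak{m})=\min\{m\geq 0\mid I\mathfrak{m}^m=\mathfrak{m}^{m+1}\}$. The Ratliff-Rush closure of an ideal $J$ is the ideal $\widetilde{J}=\bigcup_{n\geq 1}(J^{n+1}:J^n)$. If $J$ contains a non-zero-divisor, it is known that $\widetilde{J^i}=J^i$ for all $i\gg 0$, and one sets $s(J)=\min\{n\geq 1\mid \widetilde{J^i}=J^i\text{ for all } i\geq n\}$ (so, by convention, $s(J)\geq 1$). *)

theory Defs
  imports "HOL-Algebra.Algebra"
begin

locale noetherian_local_ring = cring R + noetherian_ring R
  for R (structure) and M +
  assumes maximal: "maximalideal M R"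
    and unique_maximal: "maximalideal N R \<Longrightarrow> N = M"

text \<open>Powers are taken in the multiplicative monoid of ideals \<^const>\<open>ideals_set\<close>, whose
  unit is the whole ring; hence the zeroth power of an ideal is \<open>carrier R\<close>.\<close>

abbreviation ideal_pow :: "('a, 'b) ring_scheme \<Rightarrow> 'a set \<Rightarrow> nat \<Rightarrow> 'a set"
  where "ideal_pow R J n \<equiv> J [^]\<^bsub>ideals_set R\<^esub> n"

definition ideal_colon :: "('a, 'b) ring_scheme \<Rightarrow> 'a set \<Rightarrow> 'a set \<Rightarrow> 'a set"
  where "ideal_colon R A B = {r \<in> carrier R. \<forall>b\<in>B. r \<otimes>\<^bsub>R\<^esub> b \<in> A}"

definition nonzerodivisor :: "('a, 'b) ring_scheme \<Rightarrow> 'a \<Rightarrow> bool"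
  where "nonzerodivisor R x \<longleftrightarrow>
    x \<in> carrier R \<and> (\<forall>r\<in>carrier R. r \<otimes>\<^bsub>R\<^esub> x = \<zero>\<^bsub>R\<^esub> \<longrightarrow> r = \<zero>\<^bsub>R\<^esub>)"

text \<open>For a Noetherian local ring with maximal ideal \<open>M\<close>, positive depth means that \<open>M\<close>
  contains a non-zero-divisor.\<close>

definition depth_positive :: "('a, 'b) ring_scheme \<Rightarrow> 'a set \<Rightarrow> bool"
  where "depth_positive R M \<longleftrightarrow> (\<exists>x\<in>M. nonzerodivisor R x)"

definition m_full :: "('a, 'b) ring_scheme \<Rightarrow> 'a set \<Rightarrow> 'a set \<Rightarrow> bool"
  where "m_full R M J \<longleftrightarrow>
    (\<exists>x \<in> M - ideal_pow R M 2. ideal_colon R (ideal_prod R J M) (PIdl\<^bsub>R\<^esub> x) = J)"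

definition full :: "('a, 'b) ring_scheme \<Rightarrow> 'a set \<Rightarrow> 'a set \<Rightarrow> bool"
  where "full R M J \<longleftrightarrow>
    (\<exists>x \<in> M - ideal_pow R M 2. ideal_colon R J (PIdl\<^bsub>R\<^esub> x) = ideal_colon R J M)"

definition weakly_m_full :: "('a, 'b) ring_scheme \<Rightarrow> 'a set \<Rightarrow> 'a set \<Rightarrow> bool"
  where "weakly_m_full R M J \<longleftrightarrow> ideal_colon R (ideal_prod R J M) M = J"

definition n1 :: "('a, 'b) ring_scheme \<Rightarrow> 'a set \<Rightarrow> 'a set \<Rightarrow> nat"
  where "n1 R M I = (LEAST t. \<forall>n\<ge>t. m_full R M (ideal_prod R I (ideal_pow R M n)))"

definition n2 :: "('a, 'b) ring_scheme \<Rightarrow> 'a set \<Rightarrow> 'a set \<Rightarrow> nat"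
  where "n2 R M I = (LEAST t. \<forall>n\<ge>t. full R M (ideal_prod R I (ideal_pow R M n)))"

definition n3 :: "('a, 'b) ring_scheme \<Rightarrow> 'a set \<Rightarrow> 'a set \<Rightarrow> nat"
  where "n3 R M I = (LEAST t. \<forall>n\<ge>t. weakly_m_full R M (ideal_prod R I (ideal_pow R M n)))"

definition is_reduction :: "('a, 'b) ring_scheme \<Rightarrow> 'a set \<Rightarrow> 'a set \<Rightarrow> bool"
  where "is_reduction R I J \<longleftrightarrow> ideal I R \<and> I \<subseteq> J \<and>
    (\<exists>r. ideal_prod R I (ideal_pow R J r) = ideal_pow R J (r + 1))"

definition reduction_number :: "('a, 'b) ring_scheme \<Rightarrow> 'a set \<Rightarrow> 'a set \<Rightarrow> nat"
  where "reduction_number R I J =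
    (LEAST m. ideal_prod R I (ideal_pow R J m) = ideal_pow R J (m + 1))"

definition ratliff_rush :: "('a, 'b) ring_scheme \<Rightarrow> 'a set \<Rightarrow> 'a set"
  where "ratliff_rush R J =
    (\<Union>n\<in>{1::nat..}. ideal_colon R (ideal_pow R J (n + 1)) (ideal_pow R J n))"

definition ratliff_rush_index :: "('a, 'b) ring_scheme \<Rightarrow> 'a set \<Rightarrow> nat"
  where "ratliff_rush_index R J =
    (LEAST n. n \<ge> 1 \<and> (\<forall>i\<ge>n. ratliff_rush R (ideal_pow R J i) = ideal_pow R J i))"

end

(*
  Everything rests on a superficial element: some x in M - M^2 with M^(n+1) : x = M^n for all
  large n.  The Rees algebra of M is Noetherian, so its quotient, the associated graded ring, has
  finitely many relevant associated primes; as the residue field is infinite, x can be chosen in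
  M, outside M^2 and with initial form outside all these primes.  This gives the claim
  inside some M^c, and the Artin-Rees lemma applied to a power of a non-zero-divisor removes
  that restriction.

  If M^i is Ratliff-Rush closed then M^(i+1) : x = M^i, so I M^n = M^(n+1) is M-full for all
  n >= alpha, hence weakly M-full and full.  Conversely, if I M^n is weakly M-full for all n >= t,
  then I M^(n+1) = M^(n+2) implies I M^n = M^(n+2) : M, which contains M^(n+1); descending from
  large n shows that the reduction number is at most t, and then M^(i+1) : M = M^i for all i > t
  makes these M^i Ratliff-Rush closed.
*)
theory Submission
  imports Defs
begin

text \<open>Neither the Rees algebra nor the associated graded ring is built. A homogeneous ideal is
  a sequence of ideals \<open>A n\<close> of \<open>R\<close>, and Noetherianity is the chain
  condition for such sequences, obtained by adjoining the generators of \<open>Q\<close> one at a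
  time. Finite generation, saturation, Artin-Rees and the Nakayama-type argument for M \<noteq> M^2
  are all drawn from it. The obstacle is the irrelevant ideal: it may be an associated prime of the
  associated graded ring, and no element of degree one avoids it. The elements killed by its powers
  live in finitely many degrees, which is why a bound \<open>c\<close> appears and why x at first
  cancels only inside M^c. The element x is chosen for M, not for I: once I M^n = M^(n+1), fullness
  of I M^n is a statement about powers of M alone.\<close>

no_notation Sum_Type.Plus (infixr \<open><+>\<close> 65)

subsection \<open>Ideal arithmetic\<close>

context cring
begin

lemma ideal_zero_mem: "ideal A R \<Longrightarrow> \<zero> \<in> A"
  by (simp add: additive_subgroup.zero_closed ideal.axioms(1))

lemma ideal_add_mem: "ideal A R \<Longrightarrow> a \<in> A \<Longrightarrow> b \<in> A \<Longrightarrow> a \<oplus> b \<in> A"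
  by (simp add: additive_subgroup.a_closed ideal.axioms(1))

lemma ideal_minus_mem: "ideal A R \<Longrightarrow> a \<in> A \<Longrightarrow> b \<in> A \<Longrightarrow> a \<ominus> b \<in> A"
  unfolding a_minus_def
  by (simp add: additive_subgroup.a_closed additive_subgroup.a_inv_closed ideal.axioms(1))

lemma idealI':
  assumes "A \<subseteq> carrier R" "\<zero> \<in> A"
    and add: "\<And>a b. a \<in> A \<Longrightarrow> b \<in> A \<Longrightarrow> a \<oplus> b \<in> A"
    and mult: "\<And>r a. r \<in> carrier R \<Longrightarrow> a \<in> A \<Longrightarrow> r \<otimes> a \<in> A"
  shows "ideal A R"
proof (rule idealI)
  show "ring R" by (rule ring_axioms)
  show "subgroup A (add_monoid R)"
  proof
    fix a assume "a \<in> A"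
    then have "(\<ominus> \<one>) \<otimes> a \<in> A" using mult by auto
    moreover have "(\<ominus> \<one>) \<otimes> a = inv\<^bsub>add_monoid R\<^esub> a"
      using \<open>a \<in> A\<close> assms(1) by (metis a_inv_def l_minus l_one one_closed subsetD)
    ultimately show "inv\<^bsub>add_monoid R\<^esub> a \<in> A" by simp
  qed (use assms in auto)
  show "x \<otimes> a \<in> A" "a \<otimes> x \<in> A" if "a \<in> A" "x \<in> carrier R" for a x
    using that mult[of x a] m_comm[of a x] assms(1) by auto
qed

lemma ideal_prod_subsetI:
  assumes "ideal C R" "\<And>a b. a \<in> A \<Longrightarrow> b \<in> B \<Longrightarrow> a \<otimes> b \<in> C"
  shows "ideal_prod R A B \<subseteq> C"
proof
  fix s assume "s \<in> ideal_prod R A B"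
  then show "s \<in> C"
    by induction (auto intro: assms ideal_add_mem)
qed

lemma ideal_prod_mono:
  assumes "A \<subseteq> A'" "B \<subseteq> B'"
  shows "ideal_prod R A B \<subseteq> ideal_prod R A' B'"
proof
  fix s assume "s \<in> ideal_prod R A B"
  then show "s \<in> ideal_prod R A' B'"
    by induction (use assms in \<open>auto intro: ideal_prod.intros\<close>)
qed

lemma ideals_set_simps [simp]:
  "\<one>\<^bsub>ideals_set R\<^esub> = carrier R"
  "A \<otimes>\<^bsub>ideals_set R\<^esub> B = ideal_prod R A B"
  by (simp_all add: ideals_set_def)

lemma ideal_pow_Suc: "ideal_pow R A (Suc n) = ideal_prod R (ideal_pow R A n) A"
  by simp

lemma ideal_pow_ideal: "ideal A R \<Longrightarrow> ideal (ideal_pow R A n) R"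
  by (induction n) (simp_all add: oneideal ideal_prod_is_ideal)

lemma ideal_pow_carrier: "ideal A R \<Longrightarrow> a \<in> ideal_pow R A n \<Longrightarrow> a \<in> carrier R"
  using ideal.Icarr[OF ideal_pow_ideal] .

lemma ideal_pow_1: "ideal A R \<Longrightarrow> ideal_pow R A (Suc 0) = A"
  by (simp add: ideal_prod_one ideal_prod_commute[of "carrier R" A] oneideal)

lemma ideal_pow_add:
  assumes "ideal A R"
  shows "ideal_pow R A (m + n) = ideal_prod R (ideal_pow R A m) (ideal_pow R A n)"
proof -
  interpret S: comm_monoid "ideals_set R" by (rule ideals_set_is_comm_monoid)
  have "A \<in> carrier (ideals_set R)" using assms by (simp add: ideals_set_def)
  from S.nat_pow_mult[OF this, of m n] show ?thesis by (simp add: ideals_set_def)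
qed

lemma ideal_pow_pow: "ideal A R \<Longrightarrow> ideal_pow R (ideal_pow R A m) n = ideal_pow R A (m * n)"
proof -
  interpret S: comm_monoid "ideals_set R" by (rule ideals_set_is_comm_monoid)
  show "ideal A R \<Longrightarrow> ideal_pow R (ideal_pow R A m) n = ideal_pow R A (m * n)"
    by (rule S.nat_pow_pow) (simp add: ideals_set_def)
qed

lemma ideal_pow_mult_mem:
  assumes "ideal A R" "a \<in> ideal_pow R A m" "b \<in> ideal_pow R A n"
  shows "a \<otimes> b \<in> ideal_pow R A (m + n)"
  unfolding ideal_pow_add[OF assms(1)] using assms by (auto intro: ideal_prod.prod)

lemma ideal_pow_mult_mem':
  assumes "ideal A R" "a \<in> A" "b \<in> ideal_pow R A n"
  shows "a \<otimes> b \<in> ideal_pow R A (Suc n)"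
  using ideal_pow_mult_mem[OF assms(1), of a 1 b n] assms ideal_pow_1 by simp

lemma ideal_pow_elem:
  assumes "ideal A R" "a \<in> A"
  shows "a [^] n \<in> ideal_pow R A n"
proof (induction n)
  case (Suc n)
  then show ?case using assms by (simp add: ideal_prod.prod)
qed simp

lemma ideal_pow_antimono:
  assumes "ideal A R" "m \<le> n"
  shows "ideal_pow R A n \<subseteq> ideal_pow R A m"
proof -
  have "ideal_pow R A (m + (n - m)) \<subseteq> ideal_pow R A m"
    unfolding ideal_pow_add[OF assms(1)]
    using ideal_prod_inter[OF ideal_pow_ideal ideal_pow_ideal] assms by blast
  with assms show ?thesis by simp
qed

section \<open>Multiples of an element and sums of ideals\<close>

lemma mem_rcoset_iff: "b \<in> A #> y \<longleftrightarrow> (\<exists>a\<in>A. b = a \<otimes> y)"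
  by (auto simp: r_coset_def)

lemma rcoset_memI: "a \<in> A \<Longrightarrow> a \<otimes> y \<in> A #> y"
  by (auto simp: mem_rcoset_iff)

lemma rcoset_ideal:
  assumes "ideal A R" "y \<in> carrier R"
  shows "ideal (A #> y) R"
proof (rule idealI')
  note carr = ideal.Icarr[OF assms(1)]
  show "A #> y \<subseteq> carrier R" using carr assms by (auto simp: mem_rcoset_iff)
  show "\<zero> \<in> A #> y" using ideal_zero_mem assms by (force simp: mem_rcoset_iff)
  show "a \<oplus> b \<in> A #> y" if "a \<in> A #> y" "b \<in> A #> y" for a b
    using that carr assms ideal_add_mem[OF assms(1)]
    by (auto simp: mem_rcoset_iff) (metis l_distr)
  show "r \<otimes> a \<in> A #> y" if "r \<in> carrier R" "a \<in> A #> y" for r a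
    using that carr assms ideal.I_l_closed[OF assms(1)]
    by (auto simp: mem_rcoset_iff) (metis m_assoc)
qed

lemma mem_set_add_iff: "c \<in> A <+> B \<longleftrightarrow> (\<exists>a\<in>A. \<exists>b\<in>B. c = a \<oplus> b)"
  by (auto simp: set_add_def')

lemma set_add_memI: "a \<in> A \<Longrightarrow> b \<in> B \<Longrightarrow> a \<oplus> b \<in> A <+> B"
  by (auto simp: mem_set_add_iff)

lemma set_add_mem1: "ideal A R \<Longrightarrow> ideal B R \<Longrightarrow> a \<in> A \<Longrightarrow> a \<in> A <+> B"
  unfolding mem_set_add_iff by (metis ideal.Icarr ideal_zero_mem r_zero)

lemma set_add_mem2: "ideal A R \<Longrightarrow> ideal B R \<Longrightarrow> b \<in> B \<Longrightarrow> b \<in> A <+> B"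
  unfolding mem_set_add_iff by (metis ideal.Icarr ideal_zero_mem l_zero)

end

subsection \<open>The ascending chain condition in Rees algebras\<close>

text \<open>A homogeneous ideal of the Rees algebra of \<open>Q\<close> is given by its graded pieces.\<close>

definition rees_family :: "('a, 'b) ring_scheme \<Rightarrow> 'a set \<Rightarrow> (nat \<Rightarrow> 'a set) \<Rightarrow> bool"
  where "rees_family R Q A \<longleftrightarrow> (\<forall>n. ideal (A n) R \<and> A n \<subseteq> ideal_pow R Q n \<and>
    (\<forall>q\<in>Q. \<forall>a\<in>A n. q \<otimes>\<^bsub>R\<^esub> a \<in> A (Suc n)))"

text \<open>Only homogeneous ideals enter. The order on families is pointwise inclusion, so a stable
  chain is stable in all degrees at once.\<close>

definition rees_acc :: "('a, 'b) ring_scheme \<Rightarrow> 'a set \<Rightarrow> bool"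
  where "rees_acc R Q \<longleftrightarrow>
    (\<forall>A :: nat \<Rightarrow> nat \<Rightarrow> 'a set. mono A \<longrightarrow> (\<forall>k. rees_family R Q (A k)) \<longrightarrow> (\<exists>K. \<forall>k\<ge>K. A k = A K))"

text \<open>The diagonal stabilizes at some \<open>J\<close>, which settles all entries with both
  indices at least \<open>J\<close>. Only the finitely many \<open>a\<close> below \<open>J\<close>
  remain, and each of these chains stabilizes by itself; hence \<open>K\<close> does not depend on
  \<open>a\<close>.\<close>

lemma double_chain_stabilizes:
  fixes L :: "nat \<Rightarrow> nat \<Rightarrow> 'x::order"
  assumes acc: "\<And>s. mono s \<Longrightarrow> (\<And>k. s k \<in> S) \<Longrightarrow> \<exists>K::nat. \<forall>k\<ge>K. s k = s K"
    and L: "\<And>k a. L k a \<in> S"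
    and mono1: "\<And>k k' a. k \<le> k' \<Longrightarrow> L k a \<le> L k' a"
    and mono2: "\<And>k a a'. a \<le> a' \<Longrightarrow> L k a \<le> L k a'"
  shows "\<exists>K. \<forall>k\<ge>K. \<forall>a. L k a = L K a"
proof -
  have "mono (\<lambda>j. L j j)"
    by (meson monoI mono1 mono2 order_trans)
  then obtain J where J: "\<And>j. j \<ge> J \<Longrightarrow> L j j = L J J"
    using acc[of "\<lambda>j. L j j"] L by blast
  have diag: "L k a = L J J" if "k \<ge> J" "a \<ge> J" for k a
  proof (rule antisym)
    show "L J J \<le> L k a" using that by (meson mono1 mono2 order_trans)
    have "L k a \<le> L (max k a) (max k a)"
      by (meson mono1 mono2 order_trans max.cobounded1 max.cobounded2)
    then show "L k a \<le> L J J" using J[of "max k a"] that by simp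
  qed
  have "\<exists>K. \<forall>k\<ge>K. L k a = L K a" for a
    using acc[of "\<lambda>k. L k a"] L mono1 by (simp add: monoI)
  then obtain f where f: "\<And>a k. k \<ge> f a \<Longrightarrow> L k a = L (f a) a" by metis
  define K where "K = Max (insert J (f ` {..<J}))"
  have KJ: "K \<ge> J" and Kf: "\<And>a. a < J \<Longrightarrow> K \<ge> f a"
    by (auto simp: K_def)
  have "L k a = L K a" if "k \<ge> K" for k a
  proof (cases "a < J")
    case True
    then show ?thesis using f[of a k] f[of a K] Kf[OF True] that by simp
  next
    case False
    then show ?thesis using diag[of k a] diag[of K a] KJ that by simp
  qed
  then show ?thesis by blast
qed

context cring
begin

text \<open>The sum of the \<open>x\<^sup>i Q\<^sup>n\<^sup>-\<^sup>i\<close> over \<open>i < a\<close>. Only \<open>a \<le> Suc n\<close> is meaningful; beyond that the truncated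
  exponent adds multiples of \<open>x\<^sup>i\<close>, which does no harm.\<close>

primrec pow_filtration :: "'a set \<Rightarrow> 'a \<Rightarrow> nat \<Rightarrow> nat \<Rightarrow> 'a set"
  where "pow_filtration Q x n 0 = {\<zero>}"
  | "pow_filtration Q x n (Suc a) = pow_filtration Q x n a <+> (ideal_pow R Q (n - a) #> x [^] a)"

lemma rees_familyD:
  assumes "rees_family R Q A"
  shows "ideal (A n) R" "a \<in> A n \<Longrightarrow> a \<in> ideal_pow R Q n" "a \<in> A n \<Longrightarrow> a \<in> carrier R"
    "q \<in> Q \<Longrightarrow> a \<in> A n \<Longrightarrow> q \<otimes> a \<in> A (Suc n)"
  using assms ideal.Icarr by (force simp: rees_family_def)+

lemma rees_family_pow_mult:
  assumes "rees_family R Q A" "ideal Q R" "a \<in> A n" "q \<in> ideal_pow R Q m"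
  shows "q \<otimes> a \<in> A (m + n)"
  using assms(3,4)
proof (induction m arbitrary: q a n)
  case 0
  then show ?case using ideal.I_l_closed[OF rees_familyD(1)[OF assms(1)]] by simp
next
  case (Suc m)
  note aC = rees_familyD(3)[OF assms(1) Suc.prems(1)]
  note qC = ideal.Icarr[OF ideal_prod_is_ideal[OF ideal_pow_ideal assms(2)]] 
  have "q \<in> ideal_prod R (ideal_pow R Q m) Q" using Suc by (simp add: ideal_pow_Suc)
  then show ?case
  proof induction
    case (prod i j)
    have "i \<otimes> (j \<otimes> a) \<in> A (m + Suc n)"
      using Suc.IH prod rees_familyD(4)[OF assms(1)] Suc.prems by blast
    then show ?case
      using prod aC assms(2) by (simp add: m_assoc ideal.Icarr ideal_pow_carrier)
  next
    case (sum s1 s2)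
    then show ?case
      using ideal_add_mem[OF rees_familyD(1)[OF assms(1)]] aC qC[OF assms(2)] by (simp add: l_distr)
  qed
qed

lemma pow_filtration_ideal:
  assumes "ideal Q R" "x \<in> carrier R"
  shows "ideal (pow_filtration Q x n a) R"
  by (induction a) (auto intro!: zeroideal add_ideals rcoset_ideal ideal_pow_ideal assms)

lemma pow_filtration_Suc_mono:
  assumes "ideal Q R" "x \<in> carrier R"
  shows "pow_filtration Q x n a \<subseteq> pow_filtration Q x n (Suc a)"
  using set_add_mem1[OF pow_filtration_ideal[OF assms]
      rcoset_ideal[OF ideal_pow_ideal[OF assms(1)] nat_pow_closed[OF assms(2)]]] by auto

lemma pow_filtration_mult:
  assumes "ideal Q R" "x \<in> carrier R" "q \<in> Q" "h \<in> pow_filtration Q x n a"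
  shows "q \<otimes> h \<in> pow_filtration Q x (Suc n) a"
  using assms(4)
proof (induction a arbitrary: h)
  case 0
  then show ?case using assms by (simp add: ideal.Icarr)
next
  case (Suc a)
  have qC: "q \<in> carrier R" using assms ideal.Icarr by metis
  obtain h' g where h: "h = h' \<oplus> g \<otimes> x [^] a" "h' \<in> pow_filtration Q x n a"
    "g \<in> ideal_pow R Q (n - a)"
    using Suc.prems by (auto simp: mem_set_add_iff mem_rcoset_iff)
  have gC: "g \<in> carrier R" and hC: "h' \<in> carrier R"
    using h ideal_pow_carrier[OF assms(1)] ideal.Icarr[OF pow_filtration_ideal[OF assms(1,2)]] by auto
  have "q \<otimes> g \<in> ideal_pow R Q (Suc n - a)"
  proof (cases "a \<le> n")
    case True
    then show ?thesis using ideal_pow_mult_mem'[OF assms(1,3) h(3)] by (simp add: Suc_diff_le)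
  next
    \<comment> \<open>Now \<open>Suc n - a\<close> is truncated to 0, so the power is the whole
      ring.\<close>
    case False
    then show ?thesis using qC gC by simp
  qed
  moreover have "q \<otimes> h = q \<otimes> h' \<oplus> (q \<otimes> g) \<otimes> x [^] a"
    using h qC gC hC assms by (simp add: r_distr m_assoc)
  ultimately show ?case
    using Suc.IH[OF h(2)] by (simp add: set_add_memI rcoset_memI)
qed

lemma pow_filtration_shift:
  assumes "ideal Q R" "x \<in> carrier R" "h \<in> pow_filtration Q x n a"
  shows "x \<otimes> h \<in> pow_filtration Q x (Suc n) (Suc a)"
  using assms(3)
proof (induction a arbitrary: h)
  case 0
  then show ?case
    using ideal_zero_mem[OF pow_filtration_ideal[OF assms(1,2)], of "Suc n" "Suc 0"] assms
    by simp
next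
  case (Suc a)
  obtain h' g where h: "h = h' \<oplus> g \<otimes> x [^] a" "h' \<in> pow_filtration Q x n a"
    "g \<in> ideal_pow R Q (n - a)"
    using Suc.prems by (auto simp: mem_set_add_iff mem_rcoset_iff)
  have gC: "g \<in> carrier R" and hC: "h' \<in> carrier R"
    using h ideal_pow_carrier[OF assms(1)] ideal.Icarr[OF pow_filtration_ideal[OF assms(1,2)]] by auto
  have "x \<otimes> h = x \<otimes> h' \<oplus> g \<otimes> x [^] Suc a"
    using h gC hC assms by (simp add: r_distr m_ac)
  moreover have "g \<in> ideal_pow R Q (Suc n - Suc a)" using h by simp
  ultimately show ?case
    using Suc.IH[OF h(2)]
    by (simp only: pow_filtration.simps(2)[of Q x "Suc n" "Suc a"] set_add_memI rcoset_memI)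
qed

text \<open>Each new factor q + r x contributes an element of \<open>Q\<close>, which keeps the
  bound on the exponent of x, and a multiple of x, which raises it by one. So elements of degree n
  behave like polynomials in x of degree at most n with coefficients in the powers of
  \<open>Q\<close>.\<close>

lemma pow_subset_pow_filtration:
  assumes "ideal Q R" "x \<in> carrier R"
  shows "ideal_pow R (Q <+> (carrier R #> x)) n \<subseteq> pow_filtration Q x n (Suc n)"
proof (induction n)
  case 0
  show ?case by (auto simp: mem_set_add_iff mem_rcoset_iff)
next
  case (Suc n)
  let ?G = "pow_filtration Q x (Suc n) (Suc (Suc n))"
  have G: "ideal ?G R" by (rule pow_filtration_ideal[OF assms])
  have "ideal_prod R (ideal_pow R (Q <+> (carrier R #> x)) n) (Q <+> (carrier R #> x)) \<subseteq> ?G"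
  proof (rule ideal_prod_subsetI[OF G])
    fix h y assume h: "h \<in> ideal_pow R (Q <+> (carrier R #> x)) n"
      and "y \<in> Q <+> (carrier R #> x)"
    then obtain q r where y: "y = q \<oplus> r \<otimes> x" "q \<in> Q" "r \<in> carrier R"
      by (auto simp: mem_set_add_iff mem_rcoset_iff)
    have h': "h \<in> pow_filtration Q x n (Suc n)" using h Suc by blast
    have hC: "h \<in> carrier R" using ideal.Icarr[OF pow_filtration_ideal[OF assms] h'] .
    have qC: "q \<in> carrier R" using y assms ideal.Icarr by metis
    have "q \<otimes> h \<in> ?G"
      using pow_filtration_mult[OF assms y(2) h'] pow_filtration_Suc_mono[OF assms] by blast
    moreover have "r \<otimes> (x \<otimes> h) \<in> ?G"
      using ideal.I_l_closed[OF G pow_filtration_shift[OF assms h'] y(3)] .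
    moreover have "h \<otimes> y = q \<otimes> h \<oplus> r \<otimes> (x \<otimes> h)"
      using y qC hC assms by (simp add: r_distr m_ac)
    ultimately show "h \<otimes> y \<in> ?G" using ideal_add_mem[OF G] by simp
  qed
  then show ?case by simp
qed

text \<open>The relative version of Hilbert's basis theorem: the leading coefficients with respect to
  \<open>x\<close> of a homogeneous ideal of the Rees algebra of \<open>Q + (x)\<close> form, for each exponent \<open>a\<close> of \<open>x\<close>,
  a homogeneous ideal of the Rees algebra of \<open>Q\<close>, which grows with \<open>a\<close>.\<close>

definition leading_coeffs :: "'a set \<Rightarrow> 'a \<Rightarrow> (nat \<Rightarrow> 'a set) \<Rightarrow> nat \<Rightarrow> nat \<Rightarrow> 'a set"
  where "leading_coeffs Q x A a p = {g \<in> ideal_pow R Q p.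
    g \<otimes> x [^] a \<in> A (p + a) <+> pow_filtration Q x (p + a) a}"

lemma leading_coeffs_rees_family:
  assumes Q: "ideal Q R" and x: "x \<in> carrier R"
    and A: "rees_family R Q' A" and Q': "Q \<subseteq> Q'"
  shows "rees_family R Q (leading_coeffs Q x A a)"
  unfolding rees_family_def
proof (intro allI conjI ballI)
  fix p
  let ?B = "\<lambda>p. A (p + a) <+> pow_filtration Q x (p + a) a"
  have B: "ideal (?B p) R" for p
    by (intro add_ideals rees_familyD[OF A] pow_filtration_ideal Q x)
  have P: "ideal (ideal_pow R Q p) R" by (rule ideal_pow_ideal[OF Q])
  show "leading_coeffs Q x A a p \<subseteq> ideal_pow R Q p" by (auto simp: leading_coeffs_def)
  show "ideal (leading_coeffs Q x A a p) R"
  proof (rule idealI')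
    show "leading_coeffs Q x A a p \<subseteq> carrier R"
      using ideal_pow_carrier[OF Q] by (auto simp: leading_coeffs_def)
    show "\<zero> \<in> leading_coeffs Q x A a p"
      using ideal_zero_mem[OF P] ideal_zero_mem[OF B] x by (simp add: leading_coeffs_def)
    show "g \<oplus> h \<in> leading_coeffs Q x A a p"
      if "g \<in> leading_coeffs Q x A a p" "h \<in> leading_coeffs Q x A a p" for g h
      using that ideal_add_mem[OF P] ideal_add_mem[OF B] x ideal.Icarr[OF P]
      by (simp add: leading_coeffs_def l_distr)
    show "r \<otimes> g \<in> leading_coeffs Q x A a p"
      if "r \<in> carrier R" "g \<in> leading_coeffs Q x A a p" for r g
      using that ideal.I_l_closed[OF P] ideal.I_l_closed[OF B] x ideal.Icarr[OF P]
      by (simp add: leading_coeffs_def m_assoc)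
  qed
  fix q g assume q: "q \<in> Q" and g: "g \<in> leading_coeffs Q x A a p"
  have qC: "q \<in> carrier R" using q Q ideal.Icarr by metis
  have gC: "g \<in> carrier R" using g ideal_pow_carrier[OF Q] by (auto simp: leading_coeffs_def)
  obtain b h where bh: "g \<otimes> x [^] a = b \<oplus> h" "b \<in> A (p + a)" "h \<in> pow_filtration Q x (p + a) a"
    using g by (auto simp: leading_coeffs_def mem_set_add_iff)
  have bC: "b \<in> carrier R" "h \<in> carrier R"
    using bh rees_familyD(3)[OF A] ideal.Icarr[OF pow_filtration_ideal[OF Q x]] by auto
  have "(q \<otimes> g) \<otimes> x [^] a = q \<otimes> b \<oplus> q \<otimes> h"
    using bh bC qC gC x by (simp add: m_assoc r_distr)
  moreover have "q \<otimes> b \<in> A (Suc p + a)"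
    using rees_familyD(4)[OF A] q Q' bh by auto
  moreover have "q \<otimes> h \<in> pow_filtration Q x (Suc p + a) a"
    using pow_filtration_mult[OF Q x q bh(3)] by simp
  ultimately show "q \<otimes> g \<in> leading_coeffs Q x A a (Suc p)"
    using ideal_pow_mult_mem'[OF Q q, of g p] g unfolding leading_coeffs_def mem_set_add_iff by blast
qed

lemma leading_coeffs_Suc_mono:
  assumes Q: "ideal Q R" and x: "x \<in> carrier R"
    and A: "rees_family R Q' A" and Q': "x \<in> Q'"
  shows "leading_coeffs Q x A a \<le> leading_coeffs Q x A (Suc a)"
proof (rule le_funI, rule subsetI)
  fix p g assume g: "g \<in> leading_coeffs Q x A a p"
  have gC: "g \<in> carrier R" using g ideal_pow_carrier[OF Q] by (auto simp: leading_coeffs_def)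
  obtain b h where bh: "g \<otimes> x [^] a = b \<oplus> h" "b \<in> A (p + a)" "h \<in> pow_filtration Q x (p + a) a"
    using g by (auto simp: leading_coeffs_def mem_set_add_iff)
  have bC: "b \<in> carrier R" "h \<in> carrier R"
    using bh rees_familyD(3)[OF A] ideal.Icarr[OF pow_filtration_ideal[OF Q x]] by auto
  have "g \<otimes> x [^] Suc a = x \<otimes> (g \<otimes> x [^] a)"
    using gC x by (simp add: m_ac)
  also have "\<dots> = x \<otimes> b \<oplus> x \<otimes> h"
    using bh bC x by (simp add: r_distr)
  finally have "g \<otimes> x [^] Suc a = x \<otimes> b \<oplus> x \<otimes> h" .
  moreover have "x \<otimes> b \<in> A (p + Suc a)"
    using rees_familyD(4)[OF A Q' bh(2)] by simp
  moreover have "x \<otimes> h \<in> pow_filtration Q x (p + Suc a) (Suc a)"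
    using pow_filtration_shift[OF Q x bh(3)] by simp
  ultimately show "g \<in> leading_coeffs Q x A (Suc a) p"
    using g unfolding leading_coeffs_def mem_set_add_iff by blast
qed

text \<open>Division by leading terms: if b in \<open>B n\<close> has the same leading coefficient
  as some a' in \<open>A n\<close>, then b - a' has a lower exponent of x and still lies in
  \<open>B n\<close>, so induction on the exponent puts it into \<open>A n\<close>.\<close>

lemma leading_coeffs_determine:
  assumes Q: "ideal Q R" and x: "x \<in> carrier R"
    and A: "rees_family R (Q <+> (carrier R #> x)) A"
    and B: "rees_family R (Q <+> (carrier R #> x)) B"
    and le: "A \<le> B"
    and eq: "\<And>a. leading_coeffs Q x A a = leading_coeffs Q x B a"
  shows "A = B"
proof (rule antisym[OF le], rule le_funI)
  fix n
  have AB: "A n \<subseteq> B n" using le by (simp add: le_fun_def)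
  have "B n \<inter> pow_filtration Q x n a \<subseteq> A n" if "a \<le> Suc n" for a
    using that
  proof (induction a)
    case 0
    show ?case using ideal_zero_mem[OF rees_familyD(1)[OF A]] by auto
  next
    case (Suc a)
    show ?case
    proof
      fix b assume b: "b \<in> B n \<inter> pow_filtration Q x n (Suc a)"
      then obtain h g where h: "b = h \<oplus> g \<otimes> x [^] a" "h \<in> pow_filtration Q x n a"
        "g \<in> ideal_pow R Q (n - a)"
        by (auto simp: mem_set_add_iff mem_rcoset_iff)
      have G: "ideal (pow_filtration Q x n a) R" by (rule pow_filtration_ideal[OF Q x])
      have C: "b \<in> carrier R" "h \<in> carrier R" "g \<in> carrier R"
        using b rees_familyD(3)[OF B] ideal.Icarr[OF G h(2)] ideal_pow_carrier[OF Q h(3)] by auto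
      \<comment> \<open>The bound a \<le> Suc n in the induction serves this: the subtraction is not
        truncated, so the coefficient sits in degree \<open>n - a\<close>.\<close>
      have an: "n - a + a = n" using Suc.prems by simp
      have "g \<otimes> x [^] a = b \<oplus> (\<zero> \<ominus> h)"
        using h(1) C x by (simp add: a_minus_def) (metis C(2) C(3) a_comm add.inv_solve_right' a_closed m_closed nat_pow_closed)
      moreover have "\<zero> \<ominus> h \<in> pow_filtration Q x n a"
        by (intro ideal_minus_mem G h ideal_zero_mem)
      ultimately have "g \<in> leading_coeffs Q x B a (n - a)"
        using b h(3) unfolding leading_coeffs_def mem_set_add_iff an by blast
      then have "g \<in> leading_coeffs Q x A a (n - a)" using eq by simp
      then obtain a' h' where a': "g \<otimes> x [^] a = a' \<oplus> h'" "a' \<in> A n" "h' \<in> pow_filtration Q x n a"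
        unfolding leading_coeffs_def mem_set_add_iff an by blast
      have C': "a' \<in> carrier R" "h' \<in> carrier R"
        using a' rees_familyD(3)[OF A] ideal.Icarr[OF G] by auto
      have b_eq: "b = a' \<oplus> (h \<oplus> h')"
        using h(1) a'(1) C C' by (simp add: a_ac)
      then have "h \<oplus> h' = b \<ominus> a'"
        using C C' by (metis a_closed a_comm a_minus_def add.inv_solve_right)
      then have "h \<oplus> h' \<in> B n"
        using ideal_minus_mem[OF rees_familyD(1)[OF B]] b a' AB by auto
      then have "h \<oplus> h' \<in> A n"
        using Suc ideal_add_mem[OF G h(2) a'(3)] by auto
      then show "b \<in> A n"
        using b_eq ideal_add_mem[OF rees_familyD(1)[OF A] a'(2)] by simp
    qed
  qed
  from this[of "Suc n"] show "B n \<subseteq> A n"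
    using pow_subset_pow_filtration[OF Q x, of n] rees_familyD(2)[OF B, of _ n] by blast
qed

text \<open>The leading coefficient ideals form a double chain, monotone in the index of the given
  chain and in the exponent of x. The chain condition for \<open>Q\<close> stops it uniformly in the
  exponent, and the leading coefficients determine the ideal.\<close>

lemma rees_acc_adjoin:
  assumes Q: "ideal Q R" and x: "x \<in> carrier R" and acc: "rees_acc R Q"
  shows "rees_acc R (Q <+> (carrier R #> x))"
  unfolding rees_acc_def
proof (intro allI impI)
  fix A :: "nat \<Rightarrow> nat \<Rightarrow> 'a set"
  assume mono: "mono A" and A: "\<forall>k. rees_family R (Q <+> (carrier R #> x)) (A k)"
  have X: "ideal (carrier R #> x) R" by (rule rcoset_ideal[OF oneideal x])
  have Q': "Q \<subseteq> Q <+> (carrier R #> x)" using set_add_mem1[OF Q X] by blast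
  have "x \<in> carrier R #> x" using x mem_rcoset_iff[of x "carrier R" x] l_one one_closed by metis
  then have xQ': "x \<in> Q <+> (carrier R #> x)" using set_add_mem2[OF Q X] by blast
  have "\<exists>K. \<forall>k\<ge>K. \<forall>a. leading_coeffs Q x (A k) a = leading_coeffs Q x (A K) a"
  proof (rule double_chain_stabilizes[where S = "{B. rees_family R Q B}"])
    show "\<exists>K::nat. \<forall>k\<ge>K. s k = s K" if "mono s" "\<And>k. s k \<in> {B. rees_family R Q B}"
      for s :: "nat \<Rightarrow> nat \<Rightarrow> 'a set"
      using acc that unfolding rees_acc_def by blast
    show "leading_coeffs Q x (A k) a \<in> {B. rees_family R Q B}" for k a
      using leading_coeffs_rees_family[OF Q x _ Q'] A by blast
    show "leading_coeffs Q x (A k) a \<le> leading_coeffs Q x (A k') a" if "k \<le> k'" for k k' a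
    proof -
      have "A k n \<subseteq> A k' n" for n using monoD[OF mono that] by (simp add: le_fun_def)
      then show ?thesis
        by (force simp: le_fun_def leading_coeffs_def mem_set_add_iff)
    qed
    show "leading_coeffs Q x (A k) a \<le> leading_coeffs Q x (A k) a'" if "a \<le> a'" for k a a'
      by (rule lift_Suc_mono_le[OF _ that]) (use leading_coeffs_Suc_mono[OF Q x _ xQ'] A in blast)
  qed
  then obtain K where K: "\<And>k a. k \<ge> K \<Longrightarrow> leading_coeffs Q x (A k) a = leading_coeffs Q x (A K) a"
    by blast
  have "A k = A K" if "k \<ge> K" for k
    using leading_coeffs_determine[OF Q x, of "A K" "A k"] A monoD[OF mono that] K[OF that] by simp
  then show "\<exists>K. \<forall>k\<ge>K. A k = A K" by blast
qed

end

section \<open>The chain condition over a Noetherian ring\<close>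

lemma (in noetherian_ring) ideal_chain_stabilizes:
  fixes s :: "nat \<Rightarrow> 'a set"
  assumes "mono s" "\<And>k. ideal (s k) R"
  shows "\<exists>K. \<forall>k\<ge>K. s k = s K"
proof -
  have "s x \<subseteq> s y \<or> s y \<subseteq> s x" for x y
    by (metis assms(1) linorder_linear monoD)
  then have "subset.chain {I. ideal I R} (range s)"
    unfolding pred_on.chain_def using assms(2) by blast
  then have "\<Union>(range s) \<in> range s"
    using ideal_chain_is_trivial by blast
  then obtain K where "\<Union>(range s) = s K" by blast
  then have "s k \<subseteq> s K" for k by blast
  then show ?thesis using assms(1) by (meson antisym monoD)
qed

text \<open>The Rees algebra of the zero ideal is \<open>R\<close> in degree 0 and zero above, so
  only the pieces of degree 0 can grow, and they form an ordinary chain of ideals of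
  \<open>R\<close>.\<close>

lemma (in cring) rees_acc_zero:
  assumes "noetherian_ring R"
  shows "rees_acc R {\<zero>}"
  unfolding rees_acc_def
proof (intro allI impI)
  fix A :: "nat \<Rightarrow> nat \<Rightarrow> 'a set"
  assume mono: "mono A" and A: "\<forall>k. rees_family R {\<zero>} (A k)"
  have "mono (\<lambda>k. A k 0)" using mono by (simp add: mono_def le_fun_def)
  then obtain K where K: "\<And>k. k \<ge> K \<Longrightarrow> A k 0 = A K 0"
    using noetherian_ring.ideal_chain_stabilizes[OF assms, of "\<lambda>k. A k 0"] rees_familyD(1) A by blast
  have zero: "A k (Suc n) = {\<zero>}" for k n
  proof -
    have "A k (Suc n) \<subseteq> ideal_prod R (ideal_pow R {\<zero>} n) {\<zero>}"
      using rees_familyD(2) A by fastforce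
    also have "\<dots> = {\<zero>}" by (rule ideal_prod_zero[OF ideal_pow_ideal[OF zeroideal]])
    finally show ?thesis using ideal_zero_mem[OF rees_familyD(1)] A by blast
  qed
  have "A k = A K" if "k \<ge> K" for k
  proof
    fix n show "A k n = A K n" using K[OF that] zero by (cases n) auto
  qed
  then show "\<exists>K. \<forall>k\<ge>K. A k = A K" by blast
qed

text \<open>A finite generating set of \<open>Q\<close> is adjoined element by element, starting
  from the zero ideal.\<close>

theorem (in cring) rees_acc:
  assumes noeth: "noetherian_ring R" and Q: "ideal Q R"
  shows "rees_acc R Q"
proof -
  obtain S where S: "S \<subseteq> carrier R" "finite S" "Q = Idl S"
    using noetherian_ring.finetely_gen[OF noeth Q] by blast
  have "rees_acc R (Idl S)"
    using S(2,1)
  proof induction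
    case empty
    have "Idl {} = {\<zero>}"
      using genideal_minimal[OF zeroideal, of "{}"] ideal_zero_mem[OF genideal_ideal[of "{}"]] by auto
    then show ?case using rees_acc_zero[OF noeth] by simp
  next
    case (insert x S)
    have x: "x \<in> carrier R" and S: "S \<subseteq> carrier R" using insert by auto
    let ?X = "carrier R #> x"
    have X: "ideal ?X R" by (rule rcoset_ideal[OF oneideal x])
    have I: "ideal (Idl S) R" by (rule genideal_ideal[OF S])
    have "x \<in> ?X" using x mem_rcoset_iff[of x "carrier R" x] l_one one_closed by metis
    then have "insert x S \<subseteq> Idl S <+> ?X"
      using set_add_mem1[OF I X] set_add_mem2[OF I X] genideal_self[OF S] by blast
    then have "Idl (insert x S) \<subseteq> Idl S <+> ?X"
      by (rule genideal_minimal[OF add_ideals[OF I X]])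
    moreover have "Idl S <+> ?X \<subseteq> Idl (insert x S)"
    proof -
      have J: "ideal (Idl (insert x S)) R" and self: "insert x S \<subseteq> Idl (insert x S)"
        using genideal_ideal[OF insert.prems] genideal_self[OF insert.prems] by auto
      have "Idl S \<subseteq> Idl (insert x S)" using genideal_minimal[OF J] self by blast
      moreover have "?X \<subseteq> Idl (insert x S)"
        using ideal.I_l_closed[OF J] self by (auto simp: mem_rcoset_iff)
      ultimately show ?thesis using ideal_add_mem[OF J] by (fastforce simp: mem_set_add_iff)
    qed
    ultimately have "Idl (insert x S) = Idl S <+> ?X" by blast
    then show ?case using rees_acc_adjoin[OF I x] insert.IH S by simp
  qed
  then show ?thesis using S(3) by simp
qed

subsection \<open>Saturation and relevant primes\<close>

context cring
begin

lemma elem_colon_ideal: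
  assumes "ideal A R" "g \<in> carrier R"
  shows "ideal {q \<in> carrier R. q \<otimes> g \<in> A} R"
  by (rule idealI')
    (use assms ideal_zero_mem[OF assms(1)] ideal_add_mem[OF assms(1)] ideal.I_l_closed[OF assms(1)]
      in \<open>auto simp: l_distr m_assoc\<close>)

lemma rees_acc_maximal:
  assumes acc: "rees_acc R Q" and fam: "\<And>A. A \<in> C \<Longrightarrow> rees_family R Q A" and "C \<noteq> {}"
  shows "\<exists>A\<in>C. \<forall>B\<in>C. A \<le> B \<longrightarrow> B = A"
proof (rule ccontr)
  assume "\<not> ?thesis"
  then have "\<exists>B. B \<in> C \<and> A < B" if "A \<in> C" for A
    using that by (metis order_less_le)
  then obtain s where s: "\<And>k::nat. s k \<in> C" "\<And>k. s k < s (Suc k)"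
    using dependent_nat_choice[of "\<lambda>_ A. A \<in> C" "\<lambda>_ A B. A < B"] \<open>C \<noteq> {}\<close> by blast
  then have "mono s" by (simp add: mono_iff_le_Suc less_imp_le)
  then obtain K where "\<And>k. k \<ge> K \<Longrightarrow> s k = s K"
    using acc s fam unfolding rees_acc_def by blast
  then show False using s(2)[of K] by (metis le_SucI order_less_irrefl order_refl)
qed

lemma ideal_prod_mult_left:
  assumes "ideal Q R" "ideal A R" "q \<in> Q" "a \<in> ideal_prod R (ideal_pow R Q m) A"
  shows "q \<otimes> a \<in> ideal_prod R (ideal_pow R Q (Suc m)) A"
proof -
  have P: "ideal (ideal_pow R Q m) R" by (rule ideal_pow_ideal[OF assms(1)])
  have "q \<otimes> a \<in> ideal_prod R Q (ideal_prod R (ideal_pow R Q m) A)"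
    using assms by (intro ideal_prod.prod)
  also have "\<dots> = ideal_prod R (ideal_pow R Q (Suc m)) A"
    by (simp add: ideal_prod_assoc[OF assms(1) P assms(2)] flip: ideal_prod_commute[OF assms(1) P])
  finally show ?thesis .
qed

text \<open>\<open>B k\<close> is the homogeneous ideal generated by the pieces of \<open>A\<close>
  in degrees up to k; beyond k the piece \<open>A k\<close> alone suffices, because it absorbs the
  products of lower pieces with powers of \<open>Q\<close>. This chain stops, so \<open>A\<close> is
  generated up to some degree K. Applied to M^n \<inter> (w) this is the Artin-Rees lemma.\<close>

lemma rees_family_finitely_generated:
  assumes acc: "rees_acc R Q" and Q: "ideal Q R" and A: "rees_family R Q A"
  obtains K where "\<And>n. n \<ge> K \<Longrightarrow> A n = ideal_prod R (ideal_pow R Q (n - K)) (A K)"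
proof -
  define B where "B k n = (if n < k then A n else ideal_prod R (ideal_pow R Q (n - k)) (A k))" for k n
  have AI: "ideal (A n) R" for n by (rule rees_familyD(1)[OF A])
  have P: "ideal (ideal_pow R Q n) R" for n by (rule ideal_pow_ideal[OF Q])
  have sub: "ideal_prod R (ideal_pow R Q m) (A k) \<subseteq> A (m + k)" for m k
    by (intro ideal_prod_subsetI AI rees_family_pow_mult[OF A Q])
  have diag: "ideal_prod R (carrier R) (A n) = A n" for n
    using ideal_prod_commute[OF AI oneideal] ideal_prod_one[OF AI] by simp
  have fam: "rees_family R Q (B k)" for k
    unfolding rees_family_def
  proof (intro allI conjI ballI)
    fix n
    show "ideal (B k n) R" unfolding B_def by (simp add: AI ideal_prod_is_ideal P)
    have "B k n \<subseteq> A n" using sub[of "n - k" k] by (auto simp: B_def)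
    then show "B k n \<subseteq> ideal_pow R Q n" using rees_familyD(2)[OF A] by blast
    fix q a assume qa: "q \<in> Q" "a \<in> B k n"
    consider "Suc n < k" | "Suc n = k" | "n \<ge> k" by linarith
    then show "q \<otimes> a \<in> B k (Suc n)"
    proof cases
      case 3
      then show ?thesis
        using ideal_prod_mult_left[OF Q AI qa(1), of a "n - k" k] qa(2)
        by (simp add: B_def Suc_diff_le)
    qed (use qa diag rees_familyD(4)[OF A] in \<open>auto simp: B_def\<close>)
  qed
  have "B k \<le> B (Suc k)" for k
  proof (rule le_funI)
    fix n
    consider "n < k" | "n = k" | "n > k" by linarith
    then show "B k n \<subseteq> B (Suc k) n"
    proof cases
      case 3
      define m where "m = n - Suc k"
      have m: "n - k = Suc m" using 3 by (simp add: m_def)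
      have "ideal_prod R (ideal_pow R Q (Suc m)) (A k)
          = ideal_prod R (ideal_pow R Q m) (ideal_prod R Q (A k))"
        by (simp add: ideal_prod_assoc[OF P Q AI])
      also have "\<dots> \<subseteq> ideal_prod R (ideal_pow R Q m) (A (Suc k))"
        using sub[of 1 k] ideal_pow_1[OF Q] by (intro ideal_prod_mono) auto
      finally show ?thesis using 3 m by (simp add: B_def m_def)
    qed (auto simp: B_def diag)
  qed
  then have "mono B" by (simp add: mono_iff_le_Suc)
  then obtain K where K: "\<And>k. k \<ge> K \<Longrightarrow> B k = B K"
    using acc fam unfolding rees_acc_def by blast
  \<comment> \<open>In degree n, \<open>B n\<close> gives \<open>A n\<close>, while
    \<open>B K\<close> gives the product.\<close>
  have "A n = ideal_prod R (ideal_pow R Q (n - K)) (A K)" if "n \<ge> K" for n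
    using fun_cong[OF K[OF that], of n] that by (simp add: B_def diag)
  then show ?thesis using that by blast
qed

text \<open>\<open>S k\<close> collects what the k-th power of \<open>Q\<close> carries into
  \<open>A\<close>. The chain stops at some k0, and \<open>S k0\<close> is generated up to some
  degree K. From degree k0 + K on, a factor Q^k0 splits off the coefficients and carries the
  generators into \<open>A\<close>; hence c = k0 + K works for every k.\<close>

lemma rees_family_saturated:
  assumes acc: "rees_acc R Q" and Q: "ideal Q R" and A: "rees_family R Q A"
  obtains c where "\<And>n k g. n \<ge> c \<Longrightarrow> g \<in> ideal_pow R Q n \<Longrightarrow>
    (\<And>q. q \<in> ideal_pow R Q k \<Longrightarrow> q \<otimes> g \<in> A (k + n)) \<Longrightarrow> g \<in> A n"
proof -
  define S where "S k n = {g \<in> ideal_pow R Q n. \<forall>q\<in>ideal_pow R Q k. q \<otimes> g \<in> A (k + n)}" for k n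
  have AI: "ideal (A n) R" for n by (rule rees_familyD(1)[OF A])
  have P: "ideal (ideal_pow R Q n) R" for n by (rule ideal_pow_ideal[OF Q])
  have PC: "g \<in> ideal_pow R Q n \<Longrightarrow> g \<in> carrier R" for g n by (rule ideal_pow_carrier[OF Q])
  have QC: "g \<in> Q \<Longrightarrow> g \<in> carrier R" for g using Q ideal.Icarr by metis
  have fam: "rees_family R Q (S k)" for k
    unfolding rees_family_def
  proof (intro allI conjI ballI)
    fix n
    show "S k n \<subseteq> ideal_pow R Q n" by (auto simp: S_def)
    show "ideal (S k n) R"
    proof (rule idealI')
      show "S k n \<subseteq> carrier R" using PC by (auto simp: S_def)
      show "\<zero> \<in> S k n" using ideal_zero_mem[OF P] ideal_zero_mem[OF AI] PC by (simp add: S_def)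
      show "a \<oplus> b \<in> S k n" if "a \<in> S k n" "b \<in> S k n" for a b
        unfolding S_def
      proof (intro CollectI conjI ballI)
        show "a \<oplus> b \<in> ideal_pow R Q n" using that ideal_add_mem[OF P] by (simp add: S_def)
        fix q assume q: "q \<in> ideal_pow R Q k"
        have "q \<otimes> (a \<oplus> b) = q \<otimes> a \<oplus> q \<otimes> b"
          using that PC[OF q] PC[of a n] PC[of b n] by (simp add: S_def r_distr)
        then show "q \<otimes> (a \<oplus> b) \<in> A (k + n)"
          using that q ideal_add_mem[OF AI] by (simp add: S_def)
      qed
      show "r \<otimes> a \<in> S k n" if "r \<in> carrier R" "a \<in> S k n" for r a
        unfolding S_def
      proof (intro CollectI conjI ballI)
        show "r \<otimes> a \<in> ideal_pow R Q n" using that ideal.I_l_closed[OF P] by (simp add: S_def)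
        fix q assume q: "q \<in> ideal_pow R Q k"
        have "q \<otimes> (r \<otimes> a) = r \<otimes> (q \<otimes> a)"
          using that PC[OF q] PC[of a n] by (simp add: S_def m_lcomm)
        then show "q \<otimes> (r \<otimes> a) \<in> A (k + n)"
          using that q ideal.I_l_closed[OF AI] by (simp add: S_def)
      qed
    qed
    fix q a assume q: "q \<in> Q" and a: "a \<in> S k n"
    show "q \<otimes> a \<in> S k (Suc n)"
      unfolding S_def
    proof (intro CollectI conjI ballI)
      show "q \<otimes> a \<in> ideal_pow R Q (Suc n)"
        using a ideal_pow_mult_mem'[OF Q q, of a n] by (simp add: S_def)
      fix p assume p: "p \<in> ideal_pow R Q k"
      have "p \<otimes> (q \<otimes> a) = q \<otimes> (p \<otimes> a)"
        using a QC[OF q] PC[OF p] PC[of a n] by (simp add: S_def m_lcomm)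
      then show "p \<otimes> (q \<otimes> a) \<in> A (k + Suc n)"
        using a p rees_familyD(4)[OF A q] by (simp add: S_def)
    qed
  qed
  have "S k \<le> S (Suc k)" for k
  proof (intro le_funI subsetI)
    fix n g assume g: "g \<in> S k n"
    then have gC: "g \<in> carrier R" using PC[of g n] by (simp add: S_def)
    have "ideal_prod R (ideal_pow R Q k) Q \<subseteq> {q \<in> carrier R. q \<otimes> g \<in> A (Suc k + n)}"
    proof (rule ideal_prod_subsetI[OF elem_colon_ideal[OF AI gC]])
      fix a b assume ab: "a \<in> ideal_pow R Q k" "b \<in> Q"
      have "b \<otimes> (a \<otimes> g) \<in> A (Suc (k + n))"
        using g ab rees_familyD(4)[OF A ab(2)] by (simp add: S_def)
      then show "a \<otimes> b \<in> {q \<in> carrier R. q \<otimes> g \<in> A (Suc k + n)}"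
        using PC[OF ab(1)] QC[OF ab(2)] gC by (simp add: m_ac)
    qed
    then show "g \<in> S (Suc k) n" using g by (auto simp: S_def)
  qed
  then have mono: "mono S" by (simp add: mono_iff_le_Suc)
  then obtain k0 where k0: "\<And>k. k \<ge> k0 \<Longrightarrow> S k = S k0"
    using acc fam unfolding rees_acc_def by blast
  have S_k0: "S k n \<subseteq> S k0 n" for k n
    using k0[of k] monoD[OF mono, of k k0] by (cases "k \<ge> k0") (auto simp: le_fun_def)
  obtain K where K: "\<And>n. n \<ge> K \<Longrightarrow> S k0 n = ideal_prod R (ideal_pow R Q (n - K)) (S k0 K)"
    using rees_family_finitely_generated[OF acc Q fam] by blast
  have S_A: "S k0 n \<subseteq> A n" if "n \<ge> k0 + K" for n
  proof -
    define m where "m = n - (k0 + K)"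
    have n: "n = m + (k0 + K)" "n - K = m + k0" using that by (auto simp: m_def)
    have SI: "ideal (S k0 K) R" by (rule rees_familyD(1)[OF fam])
    have "S k0 n = ideal_prod R (ideal_prod R (ideal_pow R Q m) (ideal_pow R Q k0)) (S k0 K)"
      using K[of n] n ideal_pow_add[OF Q] by simp
    also have "\<dots> = ideal_prod R (ideal_pow R Q m) (ideal_prod R (ideal_pow R Q k0) (S k0 K))"
      by (rule ideal_prod_assoc[OF P P SI])
    also have "\<dots> \<subseteq> ideal_prod R (ideal_pow R Q m) (A (k0 + K))"
      by (intro ideal_prod_mono ideal_prod_subsetI[OF AI]) (auto simp: S_def)
    also have "\<dots> \<subseteq> A n"
      unfolding n(1) by (intro ideal_prod_subsetI AI rees_family_pow_mult[OF A Q])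
    finally show ?thesis .
  qed
  have "g \<in> A n"
    if "n \<ge> k0 + K" "g \<in> ideal_pow R Q n" "\<And>q. q \<in> ideal_pow R Q k \<Longrightarrow> q \<otimes> g \<in> A (k + n)"
    for n k g
  proof -
    have "g \<in> S k n" using that by (simp add: S_def)
    then show ?thesis using S_k0[of k n] S_A[OF that(1)] by blast
  qed
  then show ?thesis using that by blast
qed

text \<open>The degree n is an argument because an element of \<open>R\<close> may lie in several
  powers of \<open>Q\<close>; f stands for its class in degree n modulo \<open>A\<close>.\<close>

definition graded_ann :: "'a set \<Rightarrow> (nat \<Rightarrow> 'a set) \<Rightarrow> nat \<Rightarrow> 'a \<Rightarrow> nat \<Rightarrow> 'a set"
  where "graded_ann Q A n f j = {g \<in> ideal_pow R Q j. g \<otimes> f \<in> A (j + n)}"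

lemma graded_ann_rees_family:
  assumes Q: "ideal Q R" and A: "rees_family R Q A" and f: "f \<in> carrier R"
  shows "rees_family R Q (graded_ann Q A n f)"
  unfolding rees_family_def
proof (intro allI conjI ballI)
  fix j
  have "graded_ann Q A n f j = ideal_pow R Q j \<inter> {q \<in> carrier R. q \<otimes> f \<in> A (j + n)}"
    using ideal_pow_carrier[OF Q] by (auto simp: graded_ann_def)
  then show "ideal (graded_ann Q A n f j) R"
    by (simp add: i_intersect ideal_pow_ideal[OF Q] elem_colon_ideal[OF rees_familyD(1)[OF A] f])
  show "graded_ann Q A n f j \<subseteq> ideal_pow R Q j" by (auto simp: graded_ann_def)
  show "q \<otimes> g \<in> graded_ann Q A n f (Suc j)" if "q \<in> Q" "g \<in> graded_ann Q A n f j" for q g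
    using that ideal_pow_mult_mem'[OF Q that(1)] rees_familyD(4)[OF A that(1)] ideal_pow_carrier[OF Q]
      ideal.Icarr[OF Q that(1)] f
    by (auto simp: graded_ann_def m_assoc)
qed

text \<open>The members of \<open>W\<close> are the degree one parts of the relevant associated primes of the
  quotient by \<open>A\<close>; they are found by Noetherian induction, splitting off an element whose
  annihilator is maximal among those that contain no power of the irrelevant ideal.\<close>

lemma relevant_annihilators:
  assumes acc: "rees_acc R Q" and Q: "ideal Q R" and A: "rees_family R Q A"
  shows "\<exists>W c. finite W \<and> (\<forall>V\<in>W. ideal V R \<and> V \<subset> Q) \<and>
    (\<forall>n\<ge>c. \<forall>f\<in>ideal_pow R Q n - A n. \<exists>V\<in>W. {x \<in> Q. x \<otimes> f \<in> A (Suc n)} \<subseteq> V)"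
    (is "\<exists>W c. ?P A W c")
proof (rule ccontr)
  assume "\<not> (\<exists>W c. ?P A W c)"
  \<comment> \<open>Pass to a maximal counterexample: every strictly larger family then has a
    suitable W and c.\<close>
  then have "{B. rees_family R Q B \<and> \<not> (\<exists>W c. ?P B W c)} \<noteq> {}" using A by blast
  then obtain A where A: "rees_family R Q A" and bad: "\<not> (\<exists>W c. ?P A W c)"
    and max: "\<And>B. rees_family R Q B \<Longrightarrow> \<not> (\<exists>W c. ?P B W c) \<Longrightarrow> A \<le> B \<Longrightarrow> B = A"
    using rees_acc_maximal[OF acc, of "{B. rees_family R Q B \<and> \<not> (\<exists>W c. ?P B W c)}"] by auto
  have AI: "ideal (A n) R" for n by (rule rees_familyD(1)[OF A])
  have P: "ideal (ideal_pow R Q n) R" for n by (rule ideal_pow_ideal[OF Q])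
  have PC: "g \<in> ideal_pow R Q n \<Longrightarrow> g \<in> carrier R" for g n by (rule ideal_pow_carrier[OF Q])
  have QC: "g \<in> Q \<Longrightarrow> g \<in> carrier R" for g using Q ideal.Icarr by metis
  \<comment> \<open>Relevant means that no power of the irrelevant ideal annihilates f modulo
    \<open>A\<close>. By saturation every f outside \<open>A\<close> is relevant once its degree
    reaches c.\<close>
  define relevant where "relevant n f \<longleftrightarrow> f \<in> ideal_pow R Q n \<and>
    (\<forall>k. \<exists>q\<in>ideal_pow R Q k. q \<otimes> f \<notin> A (k + n))" for n f
  obtain c where c: "\<And>n g. n \<ge> c \<Longrightarrow> g \<in> ideal_pow R Q n - A n \<Longrightarrow> relevant n g"
    using rees_family_saturated[OF acc Q A] unfolding relevant_def by (metis DiffE)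
  define C where "C = {graded_ann Q A n f | n f. relevant n f}"
  have "C \<noteq> {}"
  proof
    assume "C = {}"
    then have "\<not> relevant n f" for n f by (auto simp: C_def)
    then have "?P A {} c" using c by blast
    then show False using bad by blast
  qed
  moreover have "rees_family R Q B" if "B \<in> C" for B
    using that graded_ann_rees_family[OF Q A] PC by (auto simp: C_def relevant_def)
  ultimately obtain B where "B \<in> C" and B_max: "\<And>B'. B' \<in> C \<Longrightarrow> B \<le> B' \<Longrightarrow> B' = B"
    using rees_acc_maximal[OF acc, of C] by blast
  then obtain n f where rel: "relevant n f" and B: "B = graded_ann Q A n f" by (auto simp: C_def)
  have f: "f \<in> ideal_pow R Q n" using rel by (simp add: relevant_def)
  have fC: "f \<in> carrier R" using PC f by blast
  have fA: "f \<notin> A n"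
  proof -
    obtain q where "q \<in> ideal_pow R Q 0" "q \<otimes> f \<notin> A (0 + n)"
      using rel unfolding relevant_def by blast
    then show ?thesis using ideal.I_l_closed[OF AI[of n]] by auto
  qed
  \<comment> \<open>\<open>A'\<close> is \<open>A\<close> plus the homogeneous ideal generated by f
    in degree n. It is strictly larger than \<open>A\<close>, so maximality supplies W' and c' for
    it.\<close>
  define A' where "A' j = (if j < n then A j else A j <+> (ideal_pow R Q (j - n) #> f))" for j
  have A'I: "ideal (A' j) R" for j
    unfolding A'_def using AI add_ideals rcoset_ideal[OF P fC] by simp
  have AA': "A j \<subseteq> A' j" for j
    unfolding A'_def using set_add_mem1[OF AI rcoset_ideal[OF P fC]] by auto
  have A': "rees_family R Q A'"
    unfolding rees_family_def
  proof (intro allI conjI ballI)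
    fix j
    show "ideal (A' j) R" by (rule A'I)
    show "A' j \<subseteq> ideal_pow R Q j"
    proof (cases "j < n")
      case False
      then have "g \<otimes> f \<in> ideal_pow R Q j" if "g \<in> ideal_pow R Q (j - n)" for g
        using ideal_pow_mult_mem[OF Q that f] by simp
      then show ?thesis
        using False ideal_add_mem[OF P] rees_familyD(2)[OF A]
        by (auto simp: A'_def mem_set_add_iff mem_rcoset_iff)
    qed (use rees_familyD(2)[OF A] in \<open>auto simp: A'_def\<close>)
    fix q a assume q: "q \<in> Q" and a: "a \<in> A' j"
    show "q \<otimes> a \<in> A' (Suc j)"
    proof (cases "j < n")
      case True
      then have "a \<in> A j" using a by (simp add: A'_def)
      then show ?thesis using rees_familyD(4)[OF A q] AA' by blast
    next
      case False
      then obtain b g where bg: "a = b \<oplus> g \<otimes> f" "b \<in> A j" "g \<in> ideal_pow R Q (j - n)"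
        using a by (auto simp: A'_def mem_set_add_iff mem_rcoset_iff)
      have "q \<otimes> a = q \<otimes> b \<oplus> (q \<otimes> g) \<otimes> f"
        using bg QC[OF q] PC fC rees_familyD(3)[OF A] by (simp add: r_distr m_assoc)
      moreover have "q \<otimes> g \<in> ideal_pow R Q (Suc j - n)"
        using ideal_pow_mult_mem'[OF Q q bg(3)] False by (simp add: Suc_diff_le)
      ultimately show ?thesis
        using False rees_familyD(4)[OF A q bg(2)] by (simp add: A'_def set_add_memI rcoset_memI)
    qed
  qed
  have "f \<in> A' n"
    using set_add_mem2[OF AI rcoset_ideal[OF oneideal fC], of f n] rcoset_memI[OF one_closed, of f] fC
    by (simp add: A'_def)
  then have "A' \<noteq> A" using fA by auto
  moreover have "A \<le> A'" using AA' by (simp add: le_fun_def)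
  ultimately have "\<exists>W c. ?P A' W c" using max[OF A'] by blast
  then obtain W' c' where W': "?P A' W' c'" by blast
  have BI: "ideal (B 1) R" 
    using rees_familyD(1)[OF graded_ann_rees_family[OF Q A fC]] by (simp add: B)
  have BQ: "B 1 \<subset> Q"
  proof
    show "B 1 \<subseteq> Q" using ideal_pow_1[OF Q] by (auto simp: B graded_ann_def)
    \<comment> \<open>Relevance for k = 1 keeps \<open>B 1\<close> from being all of
      \<open>Q\<close>.\<close>
    obtain q where "q \<in> ideal_pow R Q 1" "q \<otimes> f \<notin> A (1 + n)"
      using rel unfolding relevant_def by blast
    then show "B 1 \<noteq> Q" using ideal_pow_1[OF Q] by (auto simp: B graded_ann_def)
  qed
  \<comment> \<open>Elements outside \<open>A'\<close> are handled by W'. An element of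
    \<open>A'\<close> outside \<open>A\<close> is h f modulo \<open>A\<close>, which is relevant by
    the bound c. The annihilator of h f contains that of f, hence equals it by maximality, and its
    degree one part is \<open>B 1\<close>. The bound n selects the branch of \<open>A'\<close> that
    involves f.\<close>
  have "\<exists>V\<in>insert (B 1) W'. {x \<in> Q. x \<otimes> g \<in> A (Suc j)} \<subseteq> V"
    if j: "j \<ge> max n (max c c')" and g: "g \<in> ideal_pow R Q j - A j" for j g
  proof (cases "g \<in> A' j")
    case False
    then obtain V where "V \<in> W'" "{x \<in> Q. x \<otimes> g \<in> A' (Suc j)} \<subseteq> V"
      using W' j g by (meson DiffD1 DiffI max.boundedE)
    then show ?thesis using AA'[of "Suc j"] by blast
  next
    case True
    then obtain a h where ah: "g = a \<oplus> h \<otimes> f" "a \<in> A j" "h \<in> ideal_pow R Q (j - n)"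
      using j by (auto simp: A'_def mem_set_add_iff mem_rcoset_iff)
    have C: "a \<in> carrier R" "h \<in> carrier R"
      using ah PC rees_familyD(3)[OF A] by auto
    have "h \<otimes> f \<in> ideal_pow R Q j"
      using ideal_pow_mult_mem[OF Q ah(3) f] j by simp
    moreover have "h \<otimes> f \<notin> A j"
      using g ah ideal_add_mem[OF AI] by auto
    ultimately have rel': "relevant j (h \<otimes> f)" using c j by simp
    have "B \<le> graded_ann Q A j (h \<otimes> f)"
    proof (intro le_funI subsetI)
      fix i p assume p: "p \<in> B i"
      have "h \<otimes> (p \<otimes> f) \<in> A (j - n + (i + n))"
        using rees_family_pow_mult[OF A Q _ ah(3)] p by (simp add: B graded_ann_def)
      then show "p \<in> graded_ann Q A j (h \<otimes> f) i"
        using p PC[of p i] C fC j by (simp add: B graded_ann_def m_lcomm add.commute)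
    qed
    then have eq: "graded_ann Q A j (h \<otimes> f) = B"
      using B_max rel' by (auto simp: C_def)
    have "x \<in> B 1" if x: "x \<in> Q" "x \<otimes> g \<in> A (Suc j)" for x
    proof -
      have "x \<otimes> (h \<otimes> f) = x \<otimes> g \<ominus> x \<otimes> a"
        using QC[OF x(1)] C fC unfolding ah(1) by algebra
      then have "x \<otimes> (h \<otimes> f) \<in> A (Suc j)"
        using ideal_minus_mem[OF AI x(2) rees_familyD(4)[OF A x(1) ah(2)]] by simp
      then have "x \<in> graded_ann Q A j (h \<otimes> f) 1"
        using x ideal_pow_1[OF Q] by (simp add: graded_ann_def)
      then show ?thesis using eq by simp
    qed
    then show ?thesis by blast
  qed
  then have "?P A (insert (B 1) W') (max n (max c c'))"
    using W' BI BQ by (intro conjI ballI allI impI) auto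
  then show False using bad by blast
qed

end

subsection \<open>Superficial elements\<close>

lemma (in noetherian_ring) exists_maximalideal:
  assumes J: "ideal J R" and one: "\<one> \<notin> J"
  shows "\<exists>N. maximalideal N R \<and> J \<subseteq> N"
proof -
  let ?C = "{I. ideal I R \<and> J \<subseteq> I \<and> \<one> \<notin> I}"
  have "\<exists>N\<in>?C. \<forall>I\<in>?C. N \<subseteq> I \<longrightarrow> I = N"
  proof (rule subset_Zorn_nonempty)
    show "?C \<noteq> {}" using J one by blast
    fix C assume C: "C \<noteq> {}" "subset.chain ?C C"
    then have "subset.chain {I. ideal I R} C" by (auto simp: pred_on.chain_def)
    then have "\<Union>C \<in> C" using ideal_chain_is_trivial C(1) by blast
    then show "\<Union>C \<in> ?C" using C(2) unfolding pred_on.chain_def by blast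
  qed
  then obtain N where N: "ideal N R" "J \<subseteq> N" "\<one> \<notin> N"
    and max: "\<forall>I\<in>?C. N \<subseteq> I \<longrightarrow> I = N"
    by blast
  have "maximalideal N R"
  proof (rule maximalidealI[OF N(1)])
    show "carrier R \<noteq> N" using N(3) by blast
    show "I = N \<or> I = carrier R" if "ideal I R" "N \<subseteq> I" "I \<subseteq> carrier R" for I
      using max that N(2) ideal.one_imp_carrier[OF that(1)] by blast
  qed
  then show ?thesis using N(2) by blast
qed

context noetherian_local_ring
begin

abbreviation m_pow :: "nat \<Rightarrow> 'a set"
  where "m_pow n \<equiv> ideal_pow R M n"

lemma M_ideal: "ideal M R"
  by (rule maximalideal.axioms(1)[OF maximal])

lemma M_carrier: "x \<in> M \<Longrightarrow> x \<in> carrier R"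
  using ideal.Icarr[OF M_ideal] .

lemma one_not_in_M: "\<one> \<notin> M"
  using maximalideal.I_notcarr[OF maximal] ideal.one_imp_carrier[OF M_ideal] by blast

lemmas m_pow_ideal = ideal_pow_ideal[OF M_ideal]
lemmas m_pow_carrier = ideal_pow_carrier[OF M_ideal]

lemma M_rees_acc: "rees_acc R M"
  by (rule rees_acc[OF noetherian_ring_axioms M_ideal])

section \<open>Units, avoidance of ideals and a Nakayama-type argument\<close>

lemma unit_of_not_in_M:
  assumes "u \<in> carrier R" "u \<notin> M"
  obtains v where "v \<in> carrier R" "v \<otimes> u = \<one>"
proof -
  have "\<one> \<in> carrier R #> u"
  proof (rule ccontr)
    assume "\<one> \<notin> carrier R #> u"
    then obtain N where "maximalideal N R" "carrier R #> u \<subseteq> N"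
      using exists_maximalideal[OF rcoset_ideal[OF oneideal assms(1)]] by blast
    moreover have "u \<in> carrier R #> u"
      using rcoset_memI[OF one_closed, of u] assms(1) by simp
    ultimately show False using unique_maximal assms(2) by blast
  qed
  then show ?thesis using that by (metis mem_rcoset_iff)
qed

lemma mult_not_in_M_cancel:
  assumes "ideal V R" "u \<in> carrier R" "u \<notin> M" "x \<in> carrier R" "u \<otimes> x \<in> V"
  shows "x \<in> V"
proof -
  obtain v where v: "v \<in> carrier R" "v \<otimes> u = \<one>"
    using unit_of_not_in_M assms by blast
  then have "v \<otimes> (u \<otimes> x) = x" using assms by (simp flip: m_assoc)
  then show ?thesis using ideal.I_l_closed[OF assms(1,5) v(1)] by simp
qed

text \<open>The members of W are arbitrary proper subideals of M, so the infinite residue field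
  takes the place of prime avoidance. If x is in U and y is not, no y + r x is in U. If each of
  these lay in a member of W, two r with different residues would share some V; the difference is a
  unit times x, which puts x into V.\<close>

lemma ideal_avoidance:
  assumes inf: "infinite (carrier (R Quot M))"
    and "finite W" "\<And>V. V \<in> W \<Longrightarrow> ideal V R \<and> V \<subset> M"
  shows "\<exists>x\<in>M. \<forall>V\<in>W. x \<notin> V"
  using assms(2,3)
proof induction
  case empty
  then show ?case using ideal_zero_mem[OF M_ideal] by blast
next
  case (insert U W)
  obtain x where x: "x \<in> M" "\<And>V. V \<in> W \<Longrightarrow> x \<notin> V" using insert by auto
  show ?case
  proof (cases "x \<in> U")
    case True
    obtain y where y: "y \<in> M" "y \<notin> U" using insert.prems by blast
    have xC: "x \<in> carrier R" and yC: "y \<in> carrier R" using x y M_carrier by auto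
    have U: "ideal U R" using insert.prems by blast
    show ?thesis
    proof (rule ccontr)
      assume contra: "\<not> ?thesis"
      have "\<exists>V\<in>W. y \<oplus> r \<otimes> x \<in> V" if r: "r \<in> carrier R" for r
      proof -
        have "y \<oplus> r \<otimes> x \<in> M"
          using ideal_add_mem[OF M_ideal y(1) ideal.I_l_closed[OF M_ideal x(1) r]] .
        then obtain V where V: "V \<in> insert U W" "y \<oplus> r \<otimes> x \<in> V" using contra by blast
        have "y = (y \<oplus> r \<otimes> x) \<ominus> r \<otimes> x" using xC yC r by algebra
        then have "V \<noteq> U"
          using y(2) V(2) ideal_minus_mem[OF U _ ideal.I_l_closed[OF U True r]] by metis
        then show ?thesis using V by blast
      qed
      then obtain F where F: "\<And>r. r \<in> carrier R \<Longrightarrow> F r \<in> W \<and> y \<oplus> r \<otimes> x \<in> F r" by metis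
      have "\<exists>r\<in>carrier R. t = M +> r" if "t \<in> carrier (R Quot M)" for t
        using that by (auto simp: FactRing_def A_RCOSETS_def')
      then obtain rep where rep: "\<And>t. t \<in> carrier (R Quot M) \<Longrightarrow> rep t \<in> carrier R \<and> t = M +> rep t"
        by metis
      have "finite ((\<lambda>t. F (rep t)) ` carrier (R Quot M))"
        using F rep by (intro finite_subset[OF _ insert.hyps(1)]) blast
      then have "\<not> inj_on (\<lambda>t. F (rep t)) (carrier (R Quot M))"
        using inf finite_imageD by blast
      then obtain s t where st: "s \<in> carrier (R Quot M)" "t \<in> carrier (R Quot M)" "s \<noteq> t"
        "F (rep s) = F (rep t)" by (auto simp: inj_on_def)
      define V where "V = F (rep s)"
      have C: "rep s \<in> carrier R" "rep t \<in> carrier R" using rep st by auto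
      have V: "V \<in> W" "y \<oplus> rep s \<otimes> x \<in> V" "y \<oplus> rep t \<otimes> x \<in> V"
        unfolding V_def using F C st(4) by (blast, blast, metis)
      have VI: "ideal V R" using V insert.prems by blast
      have "rep s \<ominus> rep t \<notin> M"
        using quotient_eq_iff_same_a_r_cos[OF M_ideal C] rep st by metis
      moreover have "(rep s \<ominus> rep t) \<otimes> x = (y \<oplus> rep s \<otimes> x) \<ominus> (y \<oplus> rep t \<otimes> x)"
        using C xC yC by algebra
      then have "(rep s \<ominus> rep t) \<otimes> x \<in> V" using ideal_minus_mem[OF VI V(2,3)] by simp
      ultimately have "x \<in> V" using mult_not_in_M_cancel[OF VI minus_closed[OF C]] xC by blast
      then show False using x(2) V(1) by blast
    qed
  qed (use x in blast)
qed

text \<open>If M^2 = M, then for each f in M the ideal (f) lies in every power of M, so the constant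
  family (f) is homogeneous. Finite generation puts f into M f, and f = p f with p in M forces f = 0
  because 1 - p is a unit. Then 0 would be the non-zero-divisor in M, giving 1 = 0.\<close>

lemma M_square_proper:
  assumes "depth_positive R M"
  shows "m_pow 2 \<subset> M"
proof
  show "m_pow 2 \<subseteq> M"
    using ideal_pow_antimono[OF M_ideal, of 1 2] ideal_pow_1[OF M_ideal] by simp
  show "m_pow 2 \<noteq> M"
  proof
    assume sq: "m_pow 2 = M"
    have pow: "m_pow (Suc n) = M" for n
    proof (induction n)
      case (Suc n)
      have "m_pow (Suc (Suc n)) = ideal_prod R M M" using Suc by simp
      also have "\<dots> = m_pow 2" using ideal_pow_1[OF M_ideal] by (simp add: numeral_2_eq_2)
      finally show ?case using sq by simp
    qed (rule ideal_pow_1[OF M_ideal])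
    have "f = \<zero>" if f: "f \<in> M" for f
    proof -
      have fC: "f \<in> carrier R" using f M_carrier by blast
      have X: "ideal (carrier R #> f) R" by (rule rcoset_ideal[OF oneideal fC])
      have "carrier R #> f \<subseteq> M"
        using ideal.I_l_closed[OF M_ideal f] by (auto simp: mem_rcoset_iff)
      then have "carrier R #> f \<subseteq> m_pow n" for n
        using pow M_carrier by (cases n) auto
      then have fam: "rees_family R M (\<lambda>n. carrier R #> f)"
        unfolding rees_family_def using X ideal.I_l_closed[OF X] M_carrier by blast
      \<comment> \<open>Taken in degree \<open>Suc K\<close>, so that the coefficients come from the
        first power of M.\<close>
      obtain K where "carrier R #> f = ideal_prod R (m_pow (Suc K - K)) (carrier R #> f)"
        using rees_family_finitely_generated[OF M_rees_acc M_ideal fam] le_SucI[OF order_refl] by metis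
      also have "\<dots> \<subseteq> M #> f"
      proof (rule ideal_prod_subsetI[OF rcoset_ideal[OF M_ideal fC]])
        fix a b assume "a \<in> m_pow (Suc K - K)" and "b \<in> carrier R #> f"
        then obtain r where r: "a \<in> M" "r \<in> carrier R" "b = r \<otimes> f"
          using ideal_pow_1[OF M_ideal] by (auto simp: mem_rcoset_iff Suc_diff_le)
        then have "a \<otimes> b = (a \<otimes> r) \<otimes> f" using M_carrier fC by (simp add: m_assoc)
        then show "a \<otimes> b \<in> M #> f"
          using rcoset_memI[OF ideal.I_r_closed[OF M_ideal r(1,2)]] by simp
      qed
      finally have "f \<in> M #> f"
        using rcoset_memI[OF one_closed, of f] fC by auto
      then obtain p where p: "p \<in> M" "f = p \<otimes> f" by (auto simp: mem_rcoset_iff)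
      have pC: "p \<in> carrier R" using p M_carrier by blast
      have "\<one> = (\<one> \<ominus> p) \<oplus> p" using pC by algebra
      then have "\<one> \<ominus> p \<notin> M" using one_not_in_M ideal_add_mem[OF M_ideal _ p(1)] by metis
      moreover have "(\<one> \<ominus> p) \<otimes> f = f \<ominus> p \<otimes> f" using pC fC by algebra
      then have "(\<one> \<ominus> p) \<otimes> f \<in> {\<zero>}" using p(2) fC by (simp add: r_neg a_minus_def)
      ultimately show "f = \<zero>"
        using mult_not_in_M_cancel[OF zeroideal, of "\<one> \<ominus> p" f] pC fC by simp
    qed
    then have "nonzerodivisor R \<zero>"
      using assms unfolding depth_positive_def by metis
    then have "\<one> = \<zero>" unfolding nonzerodivisor_def by (metis one_closed r_null)
    then show False using one_not_in_M ideal_zero_mem[OF M_ideal] by simp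
  qed
qed

lemma nonzerodivisor_power:
  assumes "nonzerodivisor R y"
  shows "nonzerodivisor R (y [^] (k::nat))"
proof (induction k)
  case 0
  then show ?case by (simp add: nonzerodivisor_def)
next
  case (Suc k)
  have y: "y \<in> carrier R" using assms by (simp add: nonzerodivisor_def)
  have "r = \<zero>" if r: "r \<in> carrier R" "r \<otimes> y [^] Suc k = \<zero>" for r
  proof -
    have "(r \<otimes> y [^] k) \<otimes> y = \<zero>" using r y by (simp add: m_assoc)
    then have "r \<otimes> y [^] k = \<zero>" using assms r y by (simp add: nonzerodivisor_def)
    then show ?thesis using Suc r by (simp add: nonzerodivisor_def)
  qed
  then show ?case using y by (simp add: nonzerodivisor_def)
qed

lemma nonzerodivisor_cancel:
  assumes "nonzerodivisor R w" "f \<in> carrier R" "g \<in> carrier R" "f \<otimes> w = g \<otimes> w"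
  shows "f = g"
proof -
  have w: "w \<in> carrier R" using assms by (simp add: nonzerodivisor_def)
  have "(f \<ominus> g) \<otimes> w = f \<otimes> w \<ominus> g \<otimes> w" using assms(2,3) w by algebra
  then have "f \<ominus> g = \<zero>"
    using assms w by (simp add: nonzerodivisor_def r_neg a_minus_def)
  then show ?thesis using assms by simp
qed

text \<open>Artin-Rees for (w) gives M^n \<inter> (w) \<subseteq> M^(n-K) w, and w cancels. One K
  serves all n and f.\<close>

lemma artin_rees_colon:
  assumes w: "nonzerodivisor R w"
  obtains K where "\<And>n f. n \<ge> K \<Longrightarrow> f \<in> carrier R \<Longrightarrow> f \<otimes> w \<in> m_pow n \<Longrightarrow> f \<in> m_pow (n - K)"
proof -
  have wC: "w \<in> carrier R" using w by (simp add: nonzerodivisor_def)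
  have X: "ideal (carrier R #> w) R" by (rule rcoset_ideal[OF oneideal wC])
  let ?A = "\<lambda>n. m_pow n \<inter> (carrier R #> w)"
  have "rees_family R M ?A"
    unfolding rees_family_def
    using i_intersect[OF m_pow_ideal X] ideal_pow_mult_mem'[OF M_ideal] ideal.I_l_closed[OF X] M_carrier
    by blast
  then obtain K where K: "\<And>n. n \<ge> K \<Longrightarrow> ?A n = ideal_prod R (m_pow (n - K)) (?A K)"
    using rees_family_finitely_generated[OF M_rees_acc M_ideal, of ?A] by blast
  have "f \<in> m_pow (n - K)" if n: "n \<ge> K" and f: "f \<in> carrier R" "f \<otimes> w \<in> m_pow n" for n f
  proof -
    have "ideal_prod R (m_pow (n - K)) (?A K) \<subseteq> m_pow (n - K) #> w"
    proof (rule ideal_prod_subsetI[OF rcoset_ideal[OF m_pow_ideal wC]])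
      fix a b assume a: "a \<in> m_pow (n - K)" and "b \<in> ?A K"
      then obtain r where r: "r \<in> carrier R" "b = r \<otimes> w" by (auto simp: mem_rcoset_iff)
      have "a \<otimes> b = (a \<otimes> r) \<otimes> w" using r m_pow_carrier[OF a] wC by (simp add: m_assoc)
      then show "a \<otimes> b \<in> m_pow (n - K) #> w"
        using rcoset_memI[OF ideal.I_r_closed[OF m_pow_ideal a r(1)]] by simp
    qed
    moreover have "f \<otimes> w \<in> ?A n" using f rcoset_memI by blast
    ultimately have "f \<otimes> w \<in> m_pow (n - K) #> w" using K[OF n] by blast
    then obtain g where g: "g \<in> m_pow (n - K)" "f \<otimes> w = g \<otimes> w"
      unfolding mem_rcoset_iff by blast
    then show ?thesis using nonzerodivisor_cancel[OF w f(1) _ g(2)] m_pow_carrier by blast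
  qed
  then show ?thesis using that by blast
qed

theorem superficial_element:
  assumes inf: "infinite (carrier (R Quot M))" and depth: "depth_positive R M"
  obtains x n0 where "x \<in> M - m_pow 2"
    "\<And>n f. n \<ge> n0 \<Longrightarrow> f \<in> carrier R \<Longrightarrow> x \<otimes> f \<in> m_pow (Suc n) \<Longrightarrow> f \<in> m_pow n"
proof -
  \<comment> \<open>The quotient of the Rees algebra by this family is the associated graded ring of
    M.\<close>
  have fam: "rees_family R M (\<lambda>n. m_pow (Suc n))"
    unfolding rees_family_def
    using m_pow_ideal ideal_pow_mult_mem'[OF M_ideal] ideal_pow_antimono[OF M_ideal le_SucI[OF order_refl]]
    by blast
  from relevant_annihilators[OF M_rees_acc M_ideal fam] obtain W c
    where W: "finite W" "\<forall>V\<in>W. ideal V R \<and> V \<subset> M"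
    and c: "\<forall>n\<ge>c. \<forall>f\<in>m_pow n - m_pow (Suc n).
      \<exists>V\<in>W. {x \<in> M. x \<otimes> f \<in> m_pow (Suc (Suc n))} \<subseteq> V"
    by (elim exE conjE)
  have "\<exists>x\<in>M. \<forall>V\<in>insert (m_pow 2) W. x \<notin> V"
    by (rule ideal_avoidance[OF inf]) (use W M_square_proper[OF depth] m_pow_ideal in auto)
  then obtain x where x: "x \<in> M" "\<forall>V\<in>insert (m_pow 2) W. x \<notin> V" by blast
  have xC: "x \<in> carrier R" using x M_carrier by blast
  \<comment> \<open>From M^c on, the degree climbs one at a time: otherwise x would annihilate the
    initial form of f and so lie in some V of W.\<close>
  have step: "f \<in> m_pow n" if "n \<ge> c" "f \<in> m_pow c" "x \<otimes> f \<in> m_pow (Suc n)" for n f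
    using that(1,3)
  proof (induction n rule: dec_induct)
    case base
    then show ?case using that(2) by simp
  next
    case (step n)
    have "x \<otimes> f \<in> m_pow (Suc n)"
      using step.prems ideal_pow_antimono[OF M_ideal, of "Suc n" "Suc (Suc n)"] by auto
    then have "f \<in> m_pow n" using step.IH by blast
    show ?case
    proof (rule ccontr)
      assume "f \<notin> m_pow (Suc n)"
      then obtain V where "V \<in> W" "{x \<in> M. x \<otimes> f \<in> m_pow (Suc (Suc n))} \<subseteq> V"
        using c step.hyps(1) \<open>f \<in> m_pow n\<close> by blast
      then show False using x step.prems by blast
    qed
  qed
  \<comment> \<open>Multiplication by y^c moves an arbitrary f into M^c, where \<open>step\<close>
    applies; Artin-Rees removes this factor at the cost of K degrees. For n \<ge> K the remaining
    exponent n + c - K is at least c, so \<open>step\<close> then applies to f itself.\<close>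
  obtain y where y: "y \<in> M" "nonzerodivisor R y" using depth by (auto simp: depth_positive_def)
  have yC: "y [^] c \<in> carrier R" using y M_carrier by simp
  obtain K where K: "\<And>n f. n \<ge> K \<Longrightarrow> f \<in> carrier R \<Longrightarrow> f \<otimes> y [^] c \<in> m_pow n \<Longrightarrow> f \<in> m_pow (n - K)"
    using artin_rees_colon[OF nonzerodivisor_power[OF y(2)]] by blast
  have "f \<in> m_pow n" if n: "n \<ge> max c K" and f: "f \<in> carrier R" "x \<otimes> f \<in> m_pow (Suc n)" for n f
  proof -
    have yc: "y [^] c \<in> m_pow c" by (rule ideal_pow_elem[OF M_ideal y(1)])
    have "f \<otimes> y [^] c \<in> m_pow c" using ideal.I_l_closed[OF m_pow_ideal yc f(1)] .
    moreover have "x \<otimes> (f \<otimes> y [^] c) \<in> m_pow (Suc (n + c))"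
      using ideal_pow_mult_mem[OF M_ideal f(2) yc] f(1) xC yC by (simp add: m_assoc)
    ultimately have "f \<otimes> y [^] c \<in> m_pow (n + c)" using step by simp
    then have "f \<in> m_pow (n + c - K)" using K[of "n + c" f] f(1) n by simp
    moreover have "c \<le> n + c - K" using n by linarith
    ultimately have "f \<in> m_pow c" using ideal_pow_antimono[OF M_ideal] by blast
    then show ?thesis using step f(2) n by simp
  qed
  then show ?thesis using that x by blast
qed

end

subsection \<open>Fullness of powers of the maximal ideal\<close>

context noetherian_local_ring
begin

lemma mem_ideal_colon_iff: "r \<in> ideal_colon R A B \<longleftrightarrow> r \<in> carrier R \<and> (\<forall>b\<in>B. r \<otimes> b \<in> A)"
  by (simp add: ideal_colon_def)

lemma mem_ideal_colon_PIdl_iff: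
  assumes "ideal A R" "x \<in> carrier R"
  shows "r \<in> ideal_colon R A (PIdl x) \<longleftrightarrow> r \<in> carrier R \<and> r \<otimes> x \<in> A"
proof -
  have "r \<otimes> b \<in> A" if "r \<in> carrier R" "r \<otimes> x \<in> A" "b \<in> PIdl x" for b
    using that assms(2) ideal.I_l_closed[OF assms(1) that(2)]
    by (auto simp: cgenideal_def m_lcomm)
  then show ?thesis using cgenideal_self[OF assms(2)] by (auto simp: mem_ideal_colon_iff)
qed

text \<open>Ratliff-Rush closedness of M^i, freed from multiples of i: k runs over all exponents, so
  that factors of M can be removed one at a time.\<close>

definition saturated_pow :: "nat \<Rightarrow> bool"
  where "saturated_pow i \<longleftrightarrow>
    (\<forall>r\<in>carrier R. \<forall>k. (\<forall>q\<in>m_pow k. r \<otimes> q \<in> m_pow (k + i)) \<longrightarrow> r \<in> m_pow i)"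

lemma m_pow_mult_mono:
  assumes r: "r \<in> carrier R" "\<forall>q\<in>m_pow k. r \<otimes> q \<in> m_pow (k + i)" and "k \<le> k'"
  shows "\<forall>q\<in>m_pow k'. r \<otimes> q \<in> m_pow (k' + i)"
proof -
  define d where "d = k' - k"
  have k': "k' = d + k" using \<open>k \<le> k'\<close> by (simp add: d_def)
  have "m_pow (d + k) \<subseteq> {q \<in> carrier R. q \<otimes> r \<in> m_pow (d + k + i)}"
    unfolding ideal_pow_add[OF M_ideal, of d k]
  proof (rule ideal_prod_subsetI[OF elem_colon_ideal[OF m_pow_ideal r(1)]])
    fix a b assume ab: "a \<in> m_pow d" "b \<in> m_pow k"
    have C: "a \<in> carrier R" "b \<in> carrier R" using ab m_pow_carrier by auto
    have "a \<otimes> (r \<otimes> b) \<in> m_pow (d + (k + i))"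
      using ideal_pow_mult_mem[OF M_ideal ab(1)] r(2) ab(2) by blast
    then show "a \<otimes> b \<in> {q \<in> carrier R. q \<otimes> r \<in> m_pow (d + k + i)}"
      using C r(1) by (simp add: m_ac add.assoc)
  qed
  then show ?thesis using k' r(1) m_pow_carrier m_comm by fastforce
qed

lemma ratliff_rush_m_pow_iff:
  assumes "i \<ge> 1"
  shows "ratliff_rush R (m_pow i) = m_pow i \<longleftrightarrow> saturated_pow i"
proof -
  have RR: "r \<in> ratliff_rush R (m_pow i) \<longleftrightarrow>
      r \<in> carrier R \<and> (\<exists>k\<ge>1. \<forall>q\<in>m_pow (i * k). r \<otimes> q \<in> m_pow (i * k + i))" for r
  proof -
    have "ideal_pow R (m_pow i) (Suc k) = m_pow (i * k + i)" for k
      unfolding ideal_pow_pow[OF M_ideal] by (simp only: mult_Suc_right add.commute)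
    then show ?thesis
      by (auto simp: ratliff_rush_def mem_ideal_colon_iff ideal_pow_pow[OF M_ideal] simp del: nat_pow_Suc)
  qed
  have sub: "m_pow i \<subseteq> ratliff_rush R (m_pow i)"
  proof
    fix r assume r: "r \<in> m_pow i"
    have "\<forall>q\<in>m_pow (i * 1). r \<otimes> q \<in> m_pow (i * 1 + i)"
      using ideal_pow_mult_mem[OF M_ideal r] by simp
    then show "r \<in> ratliff_rush R (m_pow i)"
      unfolding RR using m_pow_carrier[OF r] by blast
  qed
  show ?thesis
  proof
    assume eq: "ratliff_rush R (m_pow i) = m_pow i"
    show "saturated_pow i"
      unfolding saturated_pow_def
    proof (intro ballI allI impI)
      fix r k assume r: "r \<in> carrier R" "\<forall>q\<in>m_pow k. r \<otimes> q \<in> m_pow (k + i)"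
      \<comment> \<open>The closure sees only exponents \<open>i * m\<close> with m \<ge> 1; m =
        \<open>Suc k\<close> gives one that is at least k, since i \<ge> 1.\<close>
      have "k \<le> i * Suc k" using assms by (cases i) auto
      then have "\<forall>q\<in>m_pow (i * Suc k). r \<otimes> q \<in> m_pow (i * Suc k + i)"
        by (rule m_pow_mult_mono[OF r])
      then have "r \<in> ratliff_rush R (m_pow i)"
        unfolding RR using r(1) by (metis One_nat_def le_SucI le0 Suc_le_mono)
      then show "r \<in> m_pow i" using eq by simp
    qed
  next
    assume "saturated_pow i"
    then have "ratliff_rush R (m_pow i) \<subseteq> m_pow i"
      unfolding saturated_pow_def RR subset_iff by blast
    then show "ratliff_rush R (m_pow i) = m_pow i" using sub by blast
  qed
qed

text \<open>One factor of M is peeled off at a time: if r q p is in M^(k+i+1) for all p in M, the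
  hypothesis at exponent k + i puts r q into M^(k+i). This exponent varies with k, so the hypothesis
  speaks of all exponents from t on.\<close>

lemma saturated_pow_if_colon:
  assumes "\<And>i. i \<ge> t \<Longrightarrow> ideal_colon R (m_pow (Suc i)) M \<subseteq> m_pow i" and "i \<ge> t"
  shows "saturated_pow i"
  unfolding saturated_pow_def
proof (intro ballI allI impI)
  fix r k assume "r \<in> carrier R" "\<forall>q\<in>m_pow k. r \<otimes> q \<in> m_pow (k + i)"
  then show "r \<in> m_pow i"
  proof (induction k)
    case 0
    then show ?case using bspec[OF 0(2), of \<one>] by simp
  next
    case (Suc k)
    have "r \<otimes> q \<in> m_pow (k + i)" if q: "q \<in> m_pow k" for q
    proof -
      have qC: "q \<in> carrier R" using m_pow_carrier[OF q] .
      have "(r \<otimes> q) \<otimes> p \<in> m_pow (Suc (k + i))" if p: "p \<in> M" for p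
      proof -
        have "q \<otimes> p \<in> m_pow (Suc k)" using q p by (simp add: ideal_prod.prod)
        then have "r \<otimes> (q \<otimes> p) \<in> m_pow (Suc k + i)" using Suc.prems by blast
        then show ?thesis using Suc.prems(1) qC M_carrier[OF p] by (simp add: m_assoc)
      qed
      then have "r \<otimes> q \<in> ideal_colon R (m_pow (Suc (k + i))) M"
        using Suc.prems(1) qC by (simp add: mem_ideal_colon_iff)
      then show ?thesis using assms(1)[of "k + i"] \<open>i \<ge> t\<close> by auto
    qed
    then show ?case using Suc by blast
  qed
qed

text \<open>J \<subseteq> JM : M \<subseteq> JM : x = J for the given x in M.\<close>

lemma weakly_m_full_if_m_full:
  assumes J: "ideal J R" and "m_full R M J"
  shows "weakly_m_full R M J"
proof -
  obtain x where x: "x \<in> M" and eq: "ideal_colon R (ideal_prod R J M) (PIdl x) = J"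
    using assms by (auto simp: m_full_def)
  have JM: "ideal (ideal_prod R J M) R" by (rule ideal_prod_is_ideal[OF J M_ideal])
  have "ideal_colon R (ideal_prod R J M) M \<subseteq> ideal_colon R (ideal_prod R J M) (PIdl x)"
    unfolding subset_iff mem_ideal_colon_PIdl_iff[OF JM M_carrier[OF x]]
    using x by (simp add: mem_ideal_colon_iff)
  moreover have "J \<subseteq> ideal_colon R (ideal_prod R J M) M"
    using ideal.Icarr[OF J] by (auto simp: mem_ideal_colon_iff intro: ideal_prod.prod)
  ultimately show ?thesis unfolding weakly_m_full_def using eq by blast
qed

text \<open>If r x is in J and z is in M, then (r z) x is in JM, so r z is in JM : x = J. The same x
  serves both properties.\<close>

lemma full_if_m_full:
  assumes J: "ideal J R" and "m_full R M J"
  shows "full R M J"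
proof -
  obtain x where x: "x \<in> M - m_pow 2" and eq: "ideal_colon R (ideal_prod R J M) (PIdl x) = J"
    using assms by (auto simp: m_full_def)
  have xC: "x \<in> carrier R" using x M_carrier by blast
  have JM: "ideal (ideal_prod R J M) R" by (rule ideal_prod_is_ideal[OF J M_ideal])
  have "ideal_colon R J (PIdl x) = ideal_colon R J M"
  proof (intro equalityI subsetI)
    fix r assume "r \<in> ideal_colon R J (PIdl x)"
    then have r: "r \<in> carrier R" "r \<otimes> x \<in> J" using mem_ideal_colon_PIdl_iff[OF J xC] by auto
    have "r \<otimes> z \<in> J" if z: "z \<in> M" for z
    proof -
      have "(r \<otimes> z) \<otimes> x = (r \<otimes> x) \<otimes> z" using r xC M_carrier[OF z] by (simp add: m_ac)
      then have "(r \<otimes> z) \<otimes> x \<in> ideal_prod R J M" using ideal_prod.prod[OF r(2) z] by metis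
      then show ?thesis
        using mem_ideal_colon_PIdl_iff[OF JM xC, of "r \<otimes> z"] eq r M_carrier[OF z] by auto
    qed
    then show "r \<in> ideal_colon R J M" using r by (simp add: mem_ideal_colon_iff)
  next
    fix r assume "r \<in> ideal_colon R J M"
    then show "r \<in> ideal_colon R J (PIdl x)"
      using mem_ideal_colon_PIdl_iff[OF J xC] x by (auto simp: mem_ideal_colon_iff)
  qed
  then show ?thesis unfolding full_def using x by blast
qed

section \<open>The lower and upper bounds for the indices\<close>

lemma reduction_number_mult:
  assumes I: "is_reduction R I M"
  shows "n \<ge> reduction_number R I M \<Longrightarrow> ideal_prod R I (m_pow n) = m_pow (Suc n)"
proof (induction n rule: dec_induct)
  case base
  have "\<exists>r. ideal_prod R I (m_pow r) = m_pow (r + 1)" using I by (simp add: is_reduction_def)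
  then have "ideal_prod R I (m_pow (reduction_number R I M)) = m_pow (reduction_number R I M + 1)"
    unfolding reduction_number_def by (rule LeastI_ex)
  then show ?case by simp
next
  case (step n)
  have "ideal I R" using I by (simp add: is_reduction_def)
  then have "ideal_prod R I (m_pow (Suc n)) = ideal_prod R (ideal_prod R I (m_pow n)) M"
    by (simp add: ideal_prod_assoc m_pow_ideal M_ideal)
  then show ?case using step by simp
qed

lemma weakly_m_full_bounds:
  assumes I: "is_reduction R I M"
    and full: "\<And>n. n \<ge> t \<Longrightarrow> weakly_m_full R M (ideal_prod R I (m_pow n))"
  shows "reduction_number R I M \<le> t" and "ratliff_rush_index R M \<le> Suc t"
proof -
  have II: "ideal I R" and IM: "I \<subseteq> M" using I by (auto simp: is_reduction_def)
  have le: "ideal_prod R I (m_pow n) \<subseteq> m_pow (Suc n)" for n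
    using IM ideal_pow_mult_mem'[OF M_ideal] by (intro ideal_prod_subsetI m_pow_ideal) auto
  have assoc: "ideal_prod R (ideal_prod R I (m_pow n)) M = ideal_prod R I (m_pow (Suc n))" for n
    by (simp add: ideal_prod_assoc II m_pow_ideal M_ideal)
  \<comment> \<open>The descent to t starts at \<open>N\<close>, where the reduction equation
    already holds.\<close>
  define N where "N = max t (reduction_number R I M)"
  have eq: "ideal_prod R I (m_pow n) = m_pow (Suc n)" if "t \<le> n" for n
  proof (cases "n \<le> N")
    case True
    then show ?thesis
    proof (induction rule: inc_induct)
      case base
      show ?case by (rule reduction_number_mult[OF I]) (simp add: N_def)
    next
      case (step k)
      have "m_pow (Suc k) \<subseteq> ideal_colon R (m_pow (Suc (Suc k))) M"
        using m_pow_carrier[of _ "Suc k"]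
        by (auto simp: mem_ideal_colon_iff simp del: nat_pow_Suc) (simp add: ideal_prod.prod)
      also have "\<dots> = ideal_prod R I (m_pow k)"
        using full[of k] step that unfolding weakly_m_full_def assoc by simp
      finally show ?case using le by blast
    qed
  next
    case False
    then show ?thesis by (intro reduction_number_mult[OF I]) (simp add: N_def)
  qed
  show "reduction_number R I M \<le> t"
    unfolding reduction_number_def by (rule Least_le) (use eq[of t] in simp)
  have "saturated_pow i" if "i \<ge> Suc t" for i
  proof (rule saturated_pow_if_colon[OF _ that])
    fix i assume "i \<ge> Suc t"
    \<comment> \<open>Weak fullness of I M^n concerns M^(n+1), so closedness is obtained only from
      \<open>Suc t\<close> on; this shift accounts for the - 1 in \<alpha>.\<close>
    then obtain n where n: "i = Suc n" "n \<ge> t" by (cases i) auto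
    then show "ideal_colon R (m_pow (Suc i)) M \<subseteq> m_pow i"
      using full[OF n(2)] eq[of n] eq[of "Suc n"] unfolding weakly_m_full_def assoc by simp
  qed
  then have "\<forall>i\<ge>Suc t. ratliff_rush R (m_pow i) = m_pow i"
    using ratliff_rush_m_pow_iff by auto
  then show "ratliff_rush_index R M \<le> Suc t"
    unfolding ratliff_rush_index_def by (intro Least_le) simp
qed

lemma m_full_above:
  assumes inf: "infinite (carrier (R Quot M))" and depth: "depth_positive R M"
    and I: "is_reduction R I M"
    and n: "n \<ge> reduction_number R I M" "Suc n \<ge> ratliff_rush_index R M"
  shows "m_full R M (ideal_prod R I (m_pow n))"
proof -
  obtain x n0 where x: "x \<in> M - m_pow 2"
    and n0: "\<And>n f. n \<ge> n0 \<Longrightarrow> f \<in> carrier R \<Longrightarrow> x \<otimes> f \<in> m_pow (Suc n) \<Longrightarrow> f \<in> m_pow n"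
    using superficial_element[OF inf depth] by metis
  have xC: "x \<in> carrier R" using x M_carrier by blast
  \<comment> \<open>Closedness of all large powers shows that the minimum in
    \<open>ratliff_rush_index\<close> is attained.\<close>
  have "saturated_pow i" if "i \<ge> n0" for i
  proof (rule saturated_pow_if_colon[OF _ that])
    fix i assume "i \<ge> n0"
    then show "ideal_colon R (m_pow (Suc i)) M \<subseteq> m_pow i"
      using n0[of i] x xC m_comm by (auto simp: mem_ideal_colon_iff simp del: nat_pow_Suc)
  qed
  then have "\<exists>s\<ge>1. \<forall>i\<ge>s. ratliff_rush R (m_pow i) = m_pow i"
    using ratliff_rush_m_pow_iff by (intro exI[of _ "max 1 n0"]) auto
  then have "ratliff_rush_index R M \<ge> 1 \<and>
      (\<forall>i\<ge>ratliff_rush_index R M. ratliff_rush R (m_pow i) = m_pow i)"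
    unfolding ratliff_rush_index_def by (rule LeastI_ex)
  then have "ratliff_rush R (m_pow (Suc n)) = m_pow (Suc n)" using n(2) by blast
  then have sat: "saturated_pow (Suc n)"
    using ratliff_rush_m_pow_iff[of "Suc n"] by (simp del: nat_pow_Suc)
  have "ideal_colon R (m_pow (Suc (Suc n))) (PIdl x) = m_pow (Suc n)"
  proof (intro equalityI subsetI)
    fix r assume "r \<in> ideal_colon R (m_pow (Suc (Suc n))) (PIdl x)"
    then have r: "r \<in> carrier R" "r \<otimes> x \<in> m_pow (Suc (Suc n))"
      unfolding mem_ideal_colon_PIdl_iff[OF m_pow_ideal xC] by blast+
    \<comment> \<open>x is known to cancel only in large degrees, so it is cancelled after
      multiplication by elements of M^n0; closedness of M^(n+1) then removes this factor.\<close>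
    have "r \<otimes> q \<in> m_pow (n0 + Suc n)" if q: "q \<in> m_pow n0" for q
    proof -
      have qC: "q \<in> carrier R" using m_pow_carrier[OF q] .
      have "x \<otimes> (r \<otimes> q) = q \<otimes> (r \<otimes> x)" using r(1) qC xC by (simp add: m_ac)
      also have "\<dots> \<in> m_pow (n0 + Suc (Suc n))" by (rule ideal_pow_mult_mem[OF M_ideal q r(2)])
      finally show ?thesis using n0[of "n0 + Suc n" "r \<otimes> q"] r(1) qC by (simp del: nat_pow_Suc)
    qed
    then show "r \<in> m_pow (Suc n)" using sat r(1) unfolding saturated_pow_def by blast
  next
    fix r assume r: "r \<in> m_pow (Suc n)"
    then have "r \<otimes> x \<in> m_pow (Suc (Suc n))"
      using x by (subst ideal_pow_Suc) (auto intro: ideal_prod.prod)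
    then show "r \<in> ideal_colon R (m_pow (Suc (Suc n))) (PIdl x)"
      using mem_ideal_colon_PIdl_iff[OF m_pow_ideal xC] m_pow_carrier[OF r] by blast
  qed
  then have "ideal_colon R (ideal_prod R (ideal_prod R I (m_pow n)) M) (PIdl x) = ideal_prod R I (m_pow n)"
    using reduction_number_mult[OF I n(1)] by simp
  then show ?thesis unfolding m_full_def using x by blast
qed

end

theorem theorem3p4:
  fixes R :: "('a, 'b) ring_scheme" and M I :: "'a set" and \<alpha> :: nat
  assumes "noetherian_local_ring R M"
    and "infinite (carrier (R Quot M))"
    and "depth_positive R M"
    and "is_reduction R I M"
    and "\<alpha> = max (reduction_number R I M) (ratliff_rush_index R M - 1)"
  shows "n2 R M I \<le> n3 R M I \<and> n3 R M I = n1 R M I \<and> n1 R M I = \<alpha>"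
proof -
  interpret noetherian_local_ring R M by fact
  let ?J = "\<lambda>n. ideal_prod R I (m_pow n)"
  have J: "ideal (?J n) R" for n
    using assms(4) by (auto simp: is_reduction_def intro: ideal_prod_is_ideal m_pow_ideal)
  have m_full: "m_full R M (?J n)" if "n \<ge> \<alpha>" for n
    using m_full_above[OF assms(2-4)] that assms(5) by auto
  \<comment> \<open>Since m-fullness implies weak m-fullness, this lower bound serves
    \<open>n3\<close> and \<open>n1\<close> alike.\<close>
  have bound: "\<alpha> \<le> t" if "\<forall>n\<ge>t. weakly_m_full R M (?J n)" for t
    using weakly_m_full_bounds[OF assms(4), of t] that assms(5) by auto
  have "n3 R M I = \<alpha>"
    unfolding n3_def using m_full J weakly_m_full_if_m_full bound by (intro Least_equality) auto
  moreover have "n1 R M I = \<alpha>"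
    unfolding n1_def using m_full J weakly_m_full_if_m_full bound by (intro Least_equality) auto
  moreover have "n2 R M I \<le> \<alpha>"
    unfolding n2_def using m_full J full_if_m_full by (intro Least_le) auto
  ultimately show ?thesis by simp
qed

end
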